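(* Let $a\ge1$ be real and let $$h(\nu,x):=\frac{\partial}{\partial a}\,\frac{{}_1F_1(a;\nu;x)}{\Gamma(\nu)}.$$ Then: (1) for each fixed $x\ge0$ the function $\nu\mapsto h(\nu,x)$ is strictly discrete Wright log-concave on $(0,\infty)$. Moreover, for all real $\mu,\beta$ with $\mu\ge-1$, $\beta>0$, $\mu+\beta\ge0$, setting $\lambda_{\beta,\mu}(x):=h(\mu+1,x)h(\mu+\beta,x)-h(\mu,x)h(\mu+\beta+1,x)$: (2) all power series coefficients of $\lambda_{\beta,\mu}$ in powers of $x$ are positive, so that $\lambda_{\beta,\mu}$ is absolutely monotonic and multiplicatively convex on $(0,\infty)$; (3) $y\mapsto\lambda_{\beta,\mu}(1/y)$ is completely monotonic and log-convex on $(0,\infty)$, so that there exists a non-negative measure $\tau$ supported on $[0,\infty)$ such that $\lambda_{\beta,\mu}(x)=\int_{[0,\infty)}e^{-t/x}\,d\tau(t)$ for $x>0$; (4) $$\frac{\mu}{\beta+\mu}<\frac{h(\mu,x)h(1+\beta+\mu,x)}{h(1+\mu,x)h(\beta+\mu,x)}<1\quad\text{for all }x\ge0;$$ (5) for all $x\ge0$, $$h(\mu+1,x)h(\mu+\beta,x)-h(\mu,x)h(\mu+\beta+1,x)\ge\frac{h_0^2\,\beta}{\Gamma(\mu+1)\Gamma(\mu+\beta+1)},$$ with equality only at $x=0$, where $h_0$ is the $k=0$ member of the sequence $h_k=(\psi(a+k)-\psi(a))(a)_k/k!$.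
   Context: $\Gamma$ is Euler's gamma function, $\psi=\Gamma'/\Gamma$; $1/\Gamma$ is regarded as an entire function (equal to $0$ at $0,-1,-2,\ldots$). $(a)_0=1$, $(a)_n=a(a+1)\cdots(a+n-1)$. ${}_1F_1(a;\nu;x)=\sum_{n\ge0}\frac{(a)_n}{(\nu)_n n!}x^n$ is the Kummer function; ${}_1F_1(a;\nu;x)/\Gamma(\nu)=\sum_{n\ge0}\frac{(a)_n x^n}{n!\,\Gamma(\nu+n)}$, so $h(\nu,x)=\sum_{k\ge0}\frac{(\psi(a+k)-\psi(a))(a)_k}{\Gamma(\nu+k)\,k!}x^k$, which also defines $h(\nu,x)$ when $\nu$ is a non-positive integer. A function $F$ on an interval $I$ is discrete Wright log-concave if $F(\mu+h)F(\mu+s)-F(\mu)F(\mu+h+s)\ge0$ for all positive integers $h$, all real $s>0$ and all $\mu$ such that all arguments lie in $I$; strictly so if the inequality is strict. Log-convex means that $\log F$ is convex. Absolutely monotonic: the function and all its derivatives are non-negative. Completely monotonic on $(0,\infty)$: $(-1)^nF^{(n)}\ge0$ for all $n\ge0$. Multiplicatively convex on $(0,\infty)$: $\varphi(x^{\lambda}y^{1-\lambda})\le\varphi(x)^{\lambda}\varphi(y)^{1-\lambda}$ for all $x,y>0$, $\lambda\in[0,1]$.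
   Formalization: As h_0=0, h(ν,0)=0. So (1) is strict only for x>0 (non-strict at x=0); in (2) the coefficients of x^0, x^1 are 0 and the rest positive; (4) holds for x>0 and, at x=0, for the limit x→0+, without the lower bound there if β+μ=0, where μ/(β+μ) is undefined. *)

theory Defs
  imports "HOL-Analysis.Analysis"
begin

definition kummer :: "real \<Rightarrow> real \<Rightarrow> real \<Rightarrow> real" where
  "kummer a \<nu> x = (\<Sum>n. pochhammer a n / (pochhammer \<nu> n * fact n) * x ^ n)"

definition hcoeff :: "real \<Rightarrow> nat \<Rightarrow> real" where
  "hcoeff a k = (Digamma (a + real k) - Digamma a) * pochhammer a k / fact k"

(* The function 1/Gamma is rendered by the library's rGamma, which is 0 at 0, -1, -2, ...
   At these values of nu the Kummer series is undefined, and h is given by the series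
   that results from termwise differentiation of the regularised Kummer series. *)
definition hfun :: "real \<Rightarrow> real \<Rightarrow> real \<Rightarrow> real" where
  "hfun a \<nu> x =
     (if \<nu> \<in> \<int>\<^sub>\<le>\<^sub>0 then (\<Sum>k. hcoeff a k * rGamma (\<nu> + real k) * x ^ k)
      else deriv (\<lambda>b. kummer b \<nu> x * rGamma \<nu>) a)"

definition turanian :: "real \<Rightarrow> real \<Rightarrow> real \<Rightarrow> real \<Rightarrow> real" where
  "turanian a \<beta> \<mu> x =
     hfun a (\<mu> + 1) x * hfun a (\<mu> + \<beta>) x - hfun a \<mu> x * hfun a (\<mu> + \<beta> + 1) x"

definition discrete_wright_log_concave_on :: "real set \<Rightarrow> (real \<Rightarrow> real) \<Rightarrow> bool" where
  "discrete_wright_log_concave_on I F \<longleftrightarrow>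
     (\<forall>m::nat. \<forall>s \<mu> :: real. m > 0 \<and> s > 0 \<and>
        \<mu> \<in> I \<and> \<mu> + real m \<in> I \<and> \<mu> + s \<in> I \<and> \<mu> + real m + s \<in> I \<longrightarrow>
        F (\<mu> + real m) * F (\<mu> + s) - F \<mu> * F (\<mu> + real m + s) \<ge> 0)"

definition strictly_discrete_wright_log_concave_on :: "real set \<Rightarrow> (real \<Rightarrow> real) \<Rightarrow> bool" where
  "strictly_discrete_wright_log_concave_on I F \<longleftrightarrow>
     (\<forall>m::nat. \<forall>s \<mu> :: real. m > 0 \<and> s > 0 \<and>
        \<mu> \<in> I \<and> \<mu> + real m \<in> I \<and> \<mu> + s \<in> I \<and> \<mu> + real m + s \<in> I \<longrightarrow>
        F (\<mu> + real m) * F (\<mu> + s) - F \<mu> * F (\<mu> + real m + s) > 0)"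

(* deriv is a total operator, so infinite differentiability is required explicitly
   in the next two definitions. *)
definition absolutely_monotonic_on :: "real set \<Rightarrow> (real \<Rightarrow> real) \<Rightarrow> bool" where
  "absolutely_monotonic_on S F \<longleftrightarrow>
     (\<forall>n. \<forall>x\<in>S. (deriv ^^ n) F differentiable at x \<and> (deriv ^^ n) F x \<ge> 0)"

definition completely_monotonic_on :: "real set \<Rightarrow> (real \<Rightarrow> real) \<Rightarrow> bool" where
  "completely_monotonic_on S F \<longleftrightarrow>
     (\<forall>n. \<forall>x\<in>S. (deriv ^^ n) F differentiable at x \<and> (-1) ^ n * (deriv ^^ n) F x \<ge> 0)"

(* Positivity is part of the next two definitions: powr and ln have their usual meaning
   for positive arguments only. *)
definition multiplicatively_convex_on_pos :: "(real \<Rightarrow> real) \<Rightarrow> bool" where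
  "multiplicatively_convex_on_pos \<phi> \<longleftrightarrow>
     (\<forall>x>0. \<phi> x > 0) \<and>
     (\<forall>x>0. \<forall>y>0. \<forall>t\<in>{0..1}.
        \<phi> (x powr t * y powr (1 - t)) \<le> \<phi> x powr t * \<phi> y powr (1 - t))"

definition log_convex_on :: "real set \<Rightarrow> (real \<Rightarrow> real) \<Rightarrow> bool" where
  "log_convex_on S F \<longleftrightarrow> (\<forall>x\<in>S. F x > 0) \<and> convex_on S (\<lambda>x. ln (F x))"

definition turan_ratio :: "real \<Rightarrow> real \<Rightarrow> real \<Rightarrow> real \<Rightarrow> real" where
  "turan_ratio a \<beta> \<mu> x =
     (hfun a \<mu> x * hfun a (1 + \<beta> + \<mu>) x) / (hfun a (1 + \<mu>) x * hfun a (\<beta> + \<mu>) x)"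

end

theory Submission
  imports Defs "HOL-Probability.Distributions"
begin

text \<open>Since \<open>h\<^sub>0 = 0\<close>, one has \<open>h(\<nu>, x) = x F(\<nu> + 1, x)\<close> with
  \<open>F(m, x) = \<Sum> g\<^sub>k x\<^sup>k / \<Gamma>(m + k)\<close>, where \<open>g\<^sub>k = h\<^sub>k\<^sub>+\<^sub>1\<close> is a positive log-concave
  sequence and all \<open>m\<close> that occur are \<open>\<ge> 0\<close>. The \<open>n\<close>-th coefficient of the Turanian of \<open>F\<close> is
  \<open>\<Sum>\<^sub>j W\<^sub>j t\<^sub>j\<close> with \<open>W\<^sub>j = g\<^sub>j g\<^sub>n\<^sub>-\<^sub>j\<close>. Unweighted, the sum of the \<open>t\<^sub>j\<close> telescopes to a positive
  number. The symmetrised terms \<open>t\<^sub>j + t\<^sub>n\<^sub>-\<^sub>j\<close> change sign at most once, from \<open>-\<close> to \<open>+\<close>, as \<open>j\<close>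
  moves towards \<open>n / 2\<close>, and there \<open>W\<^sub>j\<close> increases by log-concavity; so the weighted sum is positive
  too. The analytic properties of the Turanian hold for every power series with non-negative
  coefficients; the lower bound for the ratio is a similar, termwise symmetrisation.\<close>

section \<open>Series in reciprocal gamma functions with log-concave coefficients\<close>

lemma sum_atMost_reflect:
  fixes f :: "nat \<Rightarrow> 'a::comm_monoid_add"
  shows "(\<Sum>j\<le>n. f (n - j)) = (\<Sum>j\<le>n. f j)"
  by (rule sum.reindex_bij_witness[of _ "\<lambda>i. n - i" "\<lambda>i. n - i"]) auto

text \<open>Chebyshev-type argument. Pairing \<open>j\<close> with \<open>n - j\<close> replaces
  \<open>t\<close> by its symmetrisation \<open>M\<close> at the cost of a factor 2. By
  \<open>order\<close> one threshold \<open>m\<close> separates the weights: \<open>W j\<close> is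
  at least \<open>m\<close> where \<open>M j\<close> is non-negative and at most \<open>m\<close>
  where it is negative. Hence \<open>m * M j \<le> W j * M j\<close> in either case, and summation
  gives the claim.\<close>

lemma symmetric_weighted_sum_pos:
  fixes W t :: "nat \<Rightarrow> real"
  assumes sym: "\<And>j. j \<le> n \<Longrightarrow> W (n - j) = W j" and W_pos: "\<And>j. j \<le> n \<Longrightarrow> 0 < W j"
    and t_pos: "0 < (\<Sum>j\<le>n. t j)"
    and order: "\<And>i j. i \<le> n \<Longrightarrow> j \<le> n \<Longrightarrow> t i + t (n - i) < 0 \<Longrightarrow> 0 \<le> t j + t (n - j) \<Longrightarrow> W i \<le> W j"
  shows "0 < (\<Sum>j\<le>n. W j * t j)"
proof -
  define M where "M j = t j + t (n - j)" for j
  have "(\<Sum>j\<le>n. M j) = 2 * (\<Sum>j\<le>n. t j)"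
    unfolding M_def sum.distrib sum_atMost_reflect by simp
  with t_pos have M_pos: "0 < (\<Sum>j\<le>n. M j)" by simp
  have "(\<Sum>j\<le>n. W j * t (n - j)) = (\<Sum>j\<le>n. W (n - j) * t (n - j))"
    by (intro sum.cong) (auto simp: sym)
  then have double: "(\<Sum>j\<le>n. W j * M j) = 2 * (\<Sum>j\<le>n. W j * t j)"
    using sum_atMost_reflect[of "\<lambda>j. W j * t j" n] by (simp add: M_def distrib_left sum.distrib)
  define J where "J = {j. j \<le> n \<and> 0 \<le> M j}"
  have J: "finite J" by (simp add: J_def)
  have "J \<noteq> {}"
  proof
    assume "J = {}"
    then have "M j < 0" if "j \<le> n" for j using that by (force simp: J_def)
    then have "(\<Sum>j\<le>n. M j) \<le> 0" by (intro sum_nonpos) (auto intro: less_imp_le)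
    with M_pos show False by simp
  qed
  define m where "m = Min (W ` J)"
  have m_in: "m \<in> W ` J" unfolding m_def using J \<open>J \<noteq> {}\<close> by simp
  then have "0 < m" using W_pos by (auto simp: J_def)
  have "m * M j \<le> W j * M j" if j: "j \<le> n" for j
  proof (cases "0 \<le> M j")
    case True
    then have "m \<le> W j" unfolding m_def using J j by (intro Min_le) (auto simp: J_def)
    with True show ?thesis by (intro mult_right_mono)
  next
    case False
    have "W j \<le> m" using m_in order[OF j] False by (auto simp: J_def M_def)
    with False show ?thesis by (intro mult_right_mono_neg) auto
  qed
  then have "(\<Sum>j\<le>n. m * M j) \<le> (\<Sum>j\<le>n. W j * M j)" by (intro sum_mono) auto
  then have "m * (\<Sum>j\<le>n. M j) \<le> 2 * (\<Sum>j\<le>n. W j * t j)"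
    by (simp add: double flip: sum_distrib_left)
  moreover have "0 < m * (\<Sum>j\<le>n. M j)" using \<open>0 < m\<close> M_pos by simp
  ultimately show ?thesis by linarith
qed

section \<open>Inequalities for Pochhammer symbols and reciprocal gamma values\<close>

lemma pochhammer_mono:
  fixes x y :: real
  assumes "0 \<le> x" "x \<le> y"
  shows "pochhammer x n \<le> pochhammer y n"
  unfolding pochhammer_prod using assms by (intro prod_mono) auto

lemma pochhammer_strict_mono:
  fixes x y :: real
  assumes "0 \<le> x" "x < y" "0 < n"
  shows "pochhammer x n < pochhammer y n"
proof -
  obtain k where k: "n = Suc k" using assms(3) by (cases n) auto
  have "x * pochhammer (x + 1) k \<le> x * pochhammer (y + 1) k"
    using assms by (intro mult_left_mono pochhammer_mono) auto
  also have "\<dots> < y * pochhammer (y + 1) k"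
    using assms by (intro mult_strict_right_mono pochhammer_pos) auto
  finally show ?thesis by (simp add: k pochhammer_rec)
qed

lemma rGamma_real_pos: "0 < (x::real) \<Longrightarrow> 0 < rGamma x"
  by (simp add: rGamma_inverse_Gamma)

lemma rGamma_real_nonneg: "0 \<le> (x::real) \<Longrightarrow> 0 \<le> rGamma x"
  using rGamma_real_pos[of x] by (cases "x = 0") auto

lemma rGamma_plus_one_eq: "rGamma (x + real k) = (x + real k) * rGamma (x + 1 + real k)"
  using rGamma_plus1[of "x + real k"] by (simp add: algebra_simps)

text \<open>Compares the two boundary values that remain after telescoping. Extracting the positive
  common factor \<open>rGamma (m + n + 1) * rGamma (m + \<beta> + n + 1)\<close> leaves Pochhammer
  symbols of length \<open>n + 1\<close> at \<open>m\<close> and \<open>m + \<beta>\<close>; the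
  case \<open>m = 0\<close> is covered, with left side 0.\<close>

lemma rGamma_cross_pos:
  assumes "0 \<le> m" "0 < \<beta>"
  shows "rGamma m * rGamma (m + \<beta> + 1 + real n) < rGamma (m + 1 + real n) * rGamma (m + \<beta>)"
proof -
  have "pochhammer m (Suc n) < pochhammer (m + \<beta>) (Suc n)"
    using assms by (intro pochhammer_strict_mono) auto
  moreover have "0 < rGamma (m + real (Suc n)) * rGamma (m + \<beta> + real (Suc n))"
    using assms by (intro mult_pos_pos rGamma_real_pos) auto
  ultimately have "pochhammer m (Suc n) * (rGamma (m + real (Suc n)) * rGamma (m + \<beta> + real (Suc n)))
      < pochhammer (m + \<beta>) (Suc n) * (rGamma (m + real (Suc n)) * rGamma (m + \<beta> + real (Suc n)))"
    by (rule mult_strict_right_mono)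
  then show ?thesis
    using pochhammer_rGamma[of m "Suc n"] pochhammer_rGamma[of "m + \<beta>" "Suc n"]
    by (simp add: ac_simps)
qed

text \<open>An instance of the log-convexity of the gamma function in which the shift
  \<open>j - k\<close> is an integer, so that a comparison of two Pochhammer symbols
  suffices.\<close>

lemma rGamma_cross_mono:
  assumes "0 \<le> m" "0 \<le> \<beta>" "k \<le> j"
  shows "rGamma (m + 1 + real k) * rGamma (m + \<beta> + 1 + real j)
       \<le> rGamma (m + 1 + real j) * rGamma (m + \<beta> + 1 + real k)"
proof -
  obtain i where j: "j = k + i" using assms(3) le_Suc_ex by blast
  let ?x = "m + 1 + real k"
  have "pochhammer ?x i * (rGamma (?x + real i) * rGamma (?x + \<beta> + real i))
      \<le> pochhammer (?x + \<beta>) i * (rGamma (?x + real i) * rGamma (?x + \<beta> + real i))"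
    using assms by (intro mult_right_mono mult_nonneg_nonneg rGamma_real_nonneg pochhammer_mono) auto
  then show ?thesis
    using pochhammer_rGamma[of ?x i] pochhammer_rGamma[of "?x + \<beta>" i]
    by (simp add: j ac_simps)
qed

section \<open>Terms of the Turanian and the signs of their symmetrisations\<close>

definition turan_weight :: "real \<Rightarrow> real \<Rightarrow> nat \<Rightarrow> nat \<Rightarrow> real" where
  "turan_weight m \<beta> j k = rGamma (m + 1 + real j) * rGamma (m + \<beta> + 1 + real k)"

text \<open>The factor of \<open>g j * g k\<close> in the Turanian of F, as
  \<open>turan_term_eq\<close> shows. In this form the sign is visible: for \<open>m \<ge> 0\<close>
  and \<open>\<beta> \<ge> 0\<close> the weight is positive, so the linear factor decides.\<close>

definition turan_term :: "real \<Rightarrow> real \<Rightarrow> nat \<Rightarrow> nat \<Rightarrow> real" where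
  "turan_term m \<beta> j k = turan_weight m \<beta> j k * (\<beta> + real k - real j)"

lemma turan_weight_pos: "0 \<le> m \<Longrightarrow> 0 \<le> \<beta> \<Longrightarrow> 0 < turan_weight m \<beta> j k"
  unfolding turan_weight_def by (intro mult_pos_pos rGamma_real_pos) auto

lemma turan_term_eq:
  "turan_term m \<beta> j k = rGamma (m + 1 + real j) * rGamma (m + \<beta> + real k)
     - rGamma (m + real j) * rGamma (m + \<beta> + 1 + real k)"
  unfolding turan_term_def turan_weight_def
    rGamma_plus_one_eq[of m j] rGamma_plus_one_eq[of "m + \<beta>" k]
  by (simp add: algebra_simps)

lemma sum_turan_term_pos:
  assumes "0 \<le> m" "0 < \<beta>"
  shows "0 < (\<Sum>j\<le>n. turan_term m \<beta> j (n - j))"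
proof -
  \<comment> \<open>The subtraction \<open>n - j\<close> is taken in the reals, so that
    \<open>f (Suc n)\<close> is the correct upper boundary value
    \<open>rGamma (m + n + 1) * rGamma (m + \<beta>)\<close>.\<close>
  define f where "f j = rGamma (m + real j) * rGamma (m + \<beta> + 1 + real n - real j)" for j
  have "(\<Sum>j\<le>n. turan_term m \<beta> j (n - j)) = (\<Sum>j\<le>n. f (Suc j) - f j)"
    by (intro sum.cong) (auto simp: turan_term_eq f_def of_nat_diff algebra_simps)
  also have "\<dots> = f (Suc n) - f 0"
    by (simp add: lessThan_Suc_atMost[symmetric] sum_lessThan_telescope del: sum.lessThan_Suc)
  also have "\<dots> > 0"
    using rGamma_cross_pos[OF assms, of n] by (simp add: f_def algebra_simps)
  finally show ?thesis .
qed

text \<open>The index pair moves one step inwards, from \<open>(j + 1, k)\<close> to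
  \<open>(j, k + 1)\<close>. The hypothesis bounds the ratio \<open>P / Q\<close> of two weights
  from above, and this bound is strong enough for the inner pair because of an elementary inequality
  in the distance \<open>d\<close> of the outer indices.\<close>

lemma turan_term_symm_step:
  assumes m: "0 \<le> m" and \<beta>: "0 < \<beta>" and kj: "k < j"
    and nonneg: "0 \<le> turan_term m \<beta> (Suc j) k + turan_term m \<beta> k (Suc j)"
  shows "0 \<le> turan_term m \<beta> j (Suc k) + turan_term m \<beta> (Suc k) j"
proof -
  \<comment> \<open>\<open>P\<close> and \<open>Q\<close> are the weights at
    \<open>(j + 1, k + 1)\<close> and \<open>(k + 1, j + 1)\<close>. By the recurrence of
    \<open>rGamma\<close>, each of the four weights involved is \<open>P\<close> or \<open>Q\<close>
    times one linear factor.\<close>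
  define P where "P = rGamma (m + 1 + real (Suc j)) * rGamma (m + \<beta> + 1 + real (Suc k))"
  define Q where "Q = rGamma (m + 1 + real (Suc k)) * rGamma (m + \<beta> + 1 + real (Suc j))"
  define d where "d = real j + 1 - real k"
  have P: "0 < P" and Q: "0 < Q"
    using m \<beta> unfolding P_def Q_def by (auto intro!: mult_pos_pos rGamma_real_pos)
  have rG: "rGamma (x + 1 + real i) = (x + 1 + real i) * rGamma (x + 1 + real (Suc i))" for x i
    using rGamma_plus_one_eq[of "x + 1" i] by (simp add: ac_simps)
  have w1: "turan_weight m \<beta> (Suc j) k = P * (m + \<beta> + 1 + real k)"
    unfolding turan_weight_def P_def rG[of "m + \<beta>" k] by (simp add: ac_simps)
  have w2: "turan_weight m \<beta> k (Suc j) = Q * (m + 1 + real k)"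
    unfolding turan_weight_def Q_def rG[of m k] by (simp add: ac_simps)
  have w3: "turan_weight m \<beta> j (Suc k) = P * (m + 1 + real j)"
    unfolding turan_weight_def P_def rG[of m j] by (simp add: ac_simps)
  have w4: "turan_weight m \<beta> (Suc k) j = Q * (m + \<beta> + 1 + real j)"
    unfolding turan_weight_def Q_def rG[of "m + \<beta>" j] by (simp add: ac_simps)
  have d: "2 \<le> d" using kj by (simp add: d_def)
  have goal_eq: "turan_term m \<beta> j (Suc k) + turan_term m \<beta> (Suc k) j
      = Q * (m + \<beta> + 1 + real j) * (d - 2 + \<beta>) - P * (m + 1 + real j) * (d - 2 - \<beta>)"
    unfolding turan_term_def w3 w4 d_def by (simp add: algebra_simps)
  have hyp: "P * (m + \<beta> + 1 + real k) * (d - \<beta>) \<le> Q * (m + 1 + real k) * (d + \<beta>)"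
    using nonneg unfolding turan_term_def w1 w2 d_def by (simp add: algebra_simps)
  show ?thesis
  proof (cases "d - 2 \<le> \<beta>")
    case True
    have "P * (m + 1 + real j) * (d - 2 - \<beta>) \<le> 0"
      using True P m by (intro mult_nonneg_nonpos) auto
    moreover have "0 \<le> Q * (m + \<beta> + 1 + real j) * (d - 2 + \<beta>)"
      using Q m \<beta> d by (intro mult_nonneg_nonneg) auto
    ultimately show ?thesis unfolding goal_eq by linarith
  next
    case False
    \<comment> \<open>Now \<open>d - \<beta>\<close> exceeds 2, so \<open>?A\<close> is positive;
      multiplication by it makes the left side of \<open>hyp\<close> appear, which eliminates
      \<open>P\<close>.\<close>
    let ?A = "(m + \<beta> + 1 + real k) * (d - \<beta>)"
    have A: "0 < ?A" using False m \<beta> by (intro mult_pos_pos) auto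
    have "(P * (m + 1 + real j) * (d - 2 - \<beta>)) * ?A
        = (P * (m + \<beta> + 1 + real k) * (d - \<beta>)) * ((m + 1 + real j) * (d - 2 - \<beta>))"
      by (simp add: ac_simps)
    also have "\<dots> \<le> (Q * (m + 1 + real k) * (d + \<beta>)) * ((m + 1 + real j) * (d - 2 - \<beta>))"
      using False m by (intro mult_right_mono hyp mult_nonneg_nonneg) auto
    also have "\<dots> = Q * ((m + 1 + real k) * (m + 1 + real j) * ((d + \<beta>) * (d - 2 - \<beta>)))"
      by (simp add: ac_simps)
    also have "\<dots> \<le> Q * ((m + \<beta> + 1 + real k) * (m + \<beta> + 1 + real j) * ((d - 2 + \<beta>) * (d - \<beta>)))"
    proof (rule mult_left_mono)
      have "(m + 1 + real k) * (m + 1 + real j) \<le> (m + \<beta> + 1 + real k) * (m + \<beta> + 1 + real j)"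
        using m \<beta> by (intro mult_mono) auto
      \<comment> \<open>The two sides differ by \<open>4 * \<beta>\<close>.\<close>
      moreover have "(d + \<beta>) * (d - 2 - \<beta>) \<le> (d - 2 + \<beta>) * (d - \<beta>)"
        using \<beta> by (simp add: algebra_simps)
      ultimately show "(m + 1 + real k) * (m + 1 + real j) * ((d + \<beta>) * (d - 2 - \<beta>))
          \<le> (m + \<beta> + 1 + real k) * (m + \<beta> + 1 + real j) * ((d - 2 + \<beta>) * (d - \<beta>))"
        using False m \<beta> d by (rule_tac mult_mono) auto
    qed (use Q in simp)
    also have "\<dots> = (Q * (m + \<beta> + 1 + real j) * (d - 2 + \<beta>)) * ?A"
      by (simp add: ac_simps)
    finally show ?thesis unfolding goal_eq using A by (simp add: mult_le_cancel_right)
  qed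
qed

text \<open>Iteration of the inward step up to the middle. Read contrapositively, the indices in the
  lower half with a negative symmetrised term form an initial segment: there is at most one change
  of sign.\<close>

lemma turan_term_symm_nonneg_inner:
  assumes "0 \<le> m" "0 < \<beta>" "i \<le> i'" "2 * i' \<le> n"
    and "0 \<le> turan_term m \<beta> i (n - i) + turan_term m \<beta> (n - i) i"
  shows "0 \<le> turan_term m \<beta> i' (n - i') + turan_term m \<beta> (n - i') i'"
  using assms(3,4)
proof (induction i' rule: dec_induct)
  case base
  show ?case by (fact assms(5))
next
  case (step k)
  have "k < n - Suc k" "n - k = Suc (n - Suc k)" using step by auto
  then show ?case
    using turan_term_symm_step[OF assms(1,2), of k "n - Suc k"] step by (simp add: add.commute)
qed

text \<open>Each step moves both indices one closer to \<open>n / 2\<close>; it is the hypothesis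
  with \<open>p = k\<close> and \<open>q = n - Suc k\<close>.\<close>

lemma log_concave_product_mono:
  fixes g :: "nat \<Rightarrow> real"
  assumes "\<And>p q. p \<le> q \<Longrightarrow> g p * g (Suc q) \<le> g (Suc p) * g q" "i \<le> i'" "2 * i' \<le> n"
  shows "g i * g (n - i) \<le> g i' * g (n - i')"
  using assms(2,3)
proof (induction i' rule: dec_induct)
  case (step k)
  have "k \<le> n - Suc k" "n - k = Suc (n - Suc k)" using step by auto
  then show ?case using assms(1)[of k "n - Suc k"] step by simp
qed simp

lemma turan_coeff_pos:
  fixes g :: "nat \<Rightarrow> real"
  assumes m: "0 \<le> m" and \<beta>: "0 < \<beta>" and g_pos: "\<And>k. 0 < g k"
    and g_lc: "\<And>p q. p \<le> q \<Longrightarrow> g p * g (Suc q) \<le> g (Suc p) * g q"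
  shows "0 < (\<Sum>j\<le>n. g j * g (n - j) * turan_term m \<beta> j (n - j))"
proof (rule symmetric_weighted_sum_pos)
  show "0 < (\<Sum>j\<le>n. turan_term m \<beta> j (n - j))"
    by (intro sum_turan_term_pos m \<beta>)
  fix i j
  assume ij: "i \<le> n" "j \<le> n"
    and neg: "turan_term m \<beta> i (n - i) + turan_term m \<beta> (n - i) (n - (n - i)) < 0"
    and nonneg: "0 \<le> turan_term m \<beta> j (n - j) + turan_term m \<beta> (n - j) (n - (n - j))"
  define M where "M i = turan_term m \<beta> i (n - i) + turan_term m \<beta> (n - i) i" for i
  \<comment> \<open>Both the symmetrised terms and the weights are invariant under
    \<open>i \<mapsto> n - i\<close>, so each index may be moved to the lower half.\<close>
  define i' where "i' = min i (n - i)"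
  define j' where "j' = min j (n - j)"
  have half: "2 * i' \<le> n" "2 * j' \<le> n" by (auto simp: i'_def j'_def)
  have "M i' = M i" "M j' = M j"
    using ij by (auto simp: M_def i'_def j'_def min_def add.commute)
  then have "M i' < 0" "0 \<le> M j'" using neg nonneg ij by (auto simp: M_def)
  \<comment> \<open>Otherwise non-negativity at \<open>j'\<close> would propagate inwards to
    \<open>i'\<close>.\<close>
  then have "i' \<le> j'"
    using turan_term_symm_nonneg_inner[OF m \<beta>, of j' i' n] half by (force simp: M_def)
  then have "g i' * g (n - i') \<le> g j' * g (n - j')"
    using g_lc half by (intro log_concave_product_mono)
  then show "g i * g (n - i) \<le> g j * g (n - j)"
    using ij by (auto simp: i'_def j'_def min_def mult.commute split: if_splits)
qed (use g_pos in \<open>auto simp: mult.commute\<close>)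

text \<open>\<open>u\<close> collects the coefficients of \<open>(\<mu> + \<beta>) F(\<mu> + 1)
  F(\<mu> + \<beta> + 2) - \<mu> F(\<mu> + 2) F(\<mu> + \<beta> + 1)\<close>, the lower bound for
  the ratio cleared of denominators. Here no sign change occurs: every symmetrised pair is
  positive.\<close>

lemma turan_lower_coeff_pos:
  fixes g :: "nat \<Rightarrow> real"
  assumes \<mu>: "0 < \<mu>" and \<beta>: "0 < \<beta>" and g_pos: "\<And>k. 0 < g k"
  defines "u \<equiv> \<lambda>j k. (\<mu> + \<beta>) * (rGamma (\<mu> + 1 + real j) * rGamma (\<mu> + \<beta> + 2 + real k))
     - \<mu> * (rGamma (\<mu> + 2 + real j) * rGamma (\<mu> + \<beta> + 1 + real k))"
  shows "0 < (\<Sum>j\<le>n. g j * g (n - j) * u j (n - j))"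
proof -
  have u_eq: "u j k = turan_weight (\<mu> + 1) \<beta> j k
      * ((\<mu> + \<beta>) * (1 + real j) - \<mu> * (1 + real k))" for j k
    using rGamma_plus_one_eq[of "\<mu> + 1" j] rGamma_plus_one_eq[of "\<mu> + \<beta> + 1" k]
    unfolding u_def turan_weight_def by (simp add: algebra_simps)
  have le: "0 < u j k + u k j" if "k \<le> j" for j k
  proof -
    let ?w = "turan_weight (\<mu> + 1) \<beta>"
    let ?e = "(\<mu> + \<beta>) * (1 + real j) - \<mu> * (1 + real k)"
    have "\<mu> * (1 + real k) \<le> (\<mu> + \<beta>) * (1 + real j)"
      using \<mu> \<beta> that by (intro mult_mono) auto
    moreover have "?w k j \<le> ?w j k"
      using rGamma_cross_mono[of "\<mu> + 1" \<beta> k j] \<mu> \<beta> that by (simp add: turan_weight_def)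
    ultimately have "?w k j * ?e \<le> ?w j k * ?e" by (intro mult_right_mono) auto
    \<comment> \<open>The linear factors of \<open>u j k\<close> and \<open>u k j\<close> add up to
      \<open>\<beta> * (2 + j + k)\<close>, the contributions of \<open>\<mu>\<close>
      cancelling.\<close>
    then have "?w k j * (\<beta> * (2 + real j + real k)) \<le> u j k + u k j"
      by (simp add: u_eq algebra_simps)
    moreover have "0 < ?w k j * (\<beta> * (2 + real j + real k))"
      using \<mu> \<beta> by (intro mult_pos_pos turan_weight_pos) auto
    ultimately show ?thesis by linarith
  qed
  have pos: "0 < u j k + u k j" for j k
    using le[of j k] le[of k j] by (cases "j \<le> k") (auto simp: add.commute)
  show ?thesis
  proof (rule symmetric_weighted_sum_pos)
    have "2 * (\<Sum>j\<le>n. u j (n - j)) = (\<Sum>j\<le>n. u j (n - j) + u (n - j) (n - (n - j)))"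
      unfolding sum.distrib sum_atMost_reflect[of "\<lambda>j. u j (n - j)"] by simp
    also have "\<dots> > 0" by (intro sum_pos) (auto simp: pos)
    finally show "0 < (\<Sum>j\<le>n. u j (n - j))" by simp
    \<comment> \<open>The order condition is vacuous, since \<open>pos\<close> excludes negative
      pairs.\<close>
    fix i assume "i \<le> n" "u i (n - i) + u (n - i) (n - (n - i)) < 0"
    then show "g i * g (n - i) \<le> g j * g (n - j)" for j using pos[of i "n - i"] by simp
  qed (use g_pos in \<open>auto simp: mult.commute\<close>)
qed

section \<open>Entire power series with non-negative coefficients\<close>

text \<open>Each derivative is again an everywhere convergent power series with non-negative
  coefficients, because \<open>diffs\<close> preserves both properties.\<close>

lemma absolutely_monotonic_on_power_series:
  fixes c :: "nat \<Rightarrow> real"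
  assumes c: "\<And>n. 0 \<le> c n" and summ: "\<And>x. summable (\<lambda>n. c n * x ^ n)"
    and F: "\<And>x. F x = (\<Sum>n. c n * x ^ n)"
  shows "absolutely_monotonic_on {0<..} F"
proof -
  have ex: "\<exists>d. (\<forall>k. 0 \<le> d k) \<and> (\<forall>x. summable (\<lambda>k. d k * x ^ k)) \<and>
      (deriv ^^ n) F = (\<lambda>x. \<Sum>k. d k * x ^ k)" for n
  proof (induction n)
    case 0
    show ?case using assms by (intro exI[of _ c]) auto
  next
    case (Suc n)
    then obtain d where d: "\<And>k. (0::real) \<le> d k" "\<And>x. summable (\<lambda>k. d k * x ^ k)"
      "(deriv ^^ n) F = (\<lambda>x. \<Sum>k. d k * x ^ k)" by blast
    have "deriv (\<lambda>x. \<Sum>k. d k * x ^ k) x = (\<Sum>k. diffs d k * x ^ k)" for x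
      by (intro DERIV_imp_deriv termdiffs_strong_converges_everywhere d)
    then have "(deriv ^^ Suc n) F = (\<lambda>x. \<Sum>k. diffs d k * x ^ k)"
      by (auto simp: d(3))
    moreover have "0 \<le> diffs d k" for k
      using d(1) by (simp add: diffs_def)
    moreover have "summable (\<lambda>k. diffs d k * x ^ k)" for x
      by (intro termdiff_converges_all d)
    ultimately show ?case by blast
  qed
  show ?thesis
    unfolding absolutely_monotonic_on_def
  proof (intro allI ballI conjI)
    fix n and x :: real
    assume x: "x \<in> {0<..}"
    obtain d where d: "\<And>k. 0 \<le> d k" "\<And>x. summable (\<lambda>k. d k * x ^ k)"
      "(deriv ^^ n) F = (\<lambda>x. \<Sum>k. d k * x ^ k)" using ex[of n] by blast
    show "(deriv ^^ n) F differentiable at x"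
      unfolding d(3) using termdiffs_strong_converges_everywhere[OF d(2)]
      by (rule differentiableI[OF has_field_derivative_imp_has_derivative])
    show "0 \<le> (deriv ^^ n) F x"
      unfolding d(3) using d x by (intro suminf_nonneg) auto
  qed
qed

text \<open>The derivative of \<open>c k / y ^ k\<close> is \<open>- k * c k / y ^ (k + 1)\<close>,
  so differentiation in \<open>y\<close> gives minus another power series in \<open>1 / y\<close>,
  with index shifted by one.\<close>

lemma has_field_derivative_power_series_inverse:
  fixes c :: "nat \<Rightarrow> real"
  defines "d \<equiv> \<lambda>n. case n of 0 \<Rightarrow> 0 | Suc k \<Rightarrow> real k * c k"
  assumes summ: "\<And>x. summable (\<lambda>n. c n * x ^ n)"
  shows "summable (\<lambda>n. d n * x ^ n)"
    and "0 < y \<Longrightarrow> ((\<lambda>y. \<Sum>n. c n * (1 / y) ^ n) has_real_derivative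
            - (\<Sum>n. d n * (1 / y) ^ n)) (at y)"
proof -
  \<comment> \<open>Both \<open>d 0\<close> and \<open>d 1\<close> are 0; past them,
    \<open>d (n + 2)\<close> is \<open>diffs c n\<close>, which links \<open>d\<close> to the usual
    derivative in \<open>x\<close>.\<close>
  have eq: "(\<lambda>n. d (n + 2) * x ^ (n + 2)) = (\<lambda>n. x\<^sup>2 * (diffs c n * x ^ n))" for x
    by (auto simp: diffs_def power2_eq_square d_def)
  have diffs: "summable (\<lambda>n. diffs c n * x ^ n)" for x
    by (rule termdiff_converges_all) (rule summ)
  have s2: "summable (\<lambda>n. d (n + 2) * x ^ (n + 2))" for x
    unfolding eq by (intro summable_mult diffs)
  have s: "summable (\<lambda>n. d n * x ^ n)" for x
    using s2[of x] by (subst (asm) summable_iff_shift)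
  then show "summable (\<lambda>n. d n * x ^ n)" .
  have d_sum: "(\<Sum>n. d n * x ^ n) = x\<^sup>2 * (\<Sum>n. diffs c n * x ^ n)" for x
  proof -
    have "(\<Sum>n. d n * x ^ n) = (\<Sum>n. d (n + 2) * x ^ (n + 2)) + (\<Sum>n<2. d n * x ^ n)"
      by (rule suminf_split_initial_segment[OF s])
    also have "(\<Sum>n<2. d n * x ^ n) = 0"
      by (simp add: d_def numeral_2_eq_2)
    finally show ?thesis
      unfolding eq by (simp add: suminf_mult diffs)
  qed
  show "((\<lambda>y. \<Sum>n. c n * (1 / y) ^ n) has_real_derivative
            - (\<Sum>n. d n * (1 / y) ^ n)) (at y)" if "0 < y"
  proof -
    have "((\<lambda>y. 1 / y) has_real_derivative - ((1 / y)\<^sup>2)) (at y)"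
      using that by (auto intro!: derivative_eq_intros simp: power2_eq_square)
    from DERIV_chain2[OF termdiffs_strong_converges_everywhere[OF summ] this]
    show ?thesis unfolding d_sum by (simp add: mult.commute)
  qed
qed

text \<open>Each differentiation contributes one sign and keeps the coefficients non-negative. The
  series formula is available only for \<open>y > 0\<close>, so the derivatives are compared on
  neighbourhoods inside the open half-line.\<close>

lemma completely_monotonic_on_power_series_inverse:
  fixes c :: "nat \<Rightarrow> real"
  assumes c: "\<And>n. 0 \<le> c n" and summ: "\<And>x. summable (\<lambda>n. c n * x ^ n)"
    and F: "\<And>x. F x = (\<Sum>n. c n * x ^ n)"
  shows "completely_monotonic_on {0<..} (\<lambda>y. F (1 / y))"
proof -
  let ?G = "\<lambda>y. F (1 / y)"
  have ex: "\<exists>d. (\<forall>k. 0 \<le> d k) \<and> (\<forall>x. summable (\<lambda>k. d k * x ^ k)) \<and>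
      (\<forall>y>0. (deriv ^^ n) ?G y = (-1) ^ n * (\<Sum>k. d k * (1 / y) ^ k)) \<and>
      (\<forall>y>0. (deriv ^^ n) ?G differentiable at y)" for n
  proof (induction n)
    case 0
    have "?G differentiable at y" if "y > 0" for y
      unfolding F using has_field_derivative_power_series_inverse(2)[OF summ that]
      by (rule differentiableI[OF has_field_derivative_imp_has_derivative])
    then show ?case using assms by (intro exI[of _ c]) auto
  next
    case (Suc n)
    then obtain d where d: "\<And>k. (0::real) \<le> d k" "\<And>x. summable (\<lambda>k. d k * x ^ k)"
      "\<And>y. 0 < y \<Longrightarrow> (deriv ^^ n) ?G y = (-1) ^ n * (\<Sum>k. d k * (1 / y) ^ k)" by blast
    define e where "e = (\<lambda>n. case n of 0 \<Rightarrow> 0 | Suc k \<Rightarrow> real k * d k)"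
    have e: "summable (\<lambda>k. e k * x ^ k)" "0 \<le> e k" for x k
      unfolding e_def using has_field_derivative_power_series_inverse(1)[OF d(2)] d(1)
      by (auto split: nat.splits)
    have deriv: "deriv ((deriv ^^ n) ?G) y = (-1) ^ Suc n * (\<Sum>k. e k * (1 / y) ^ k)"
      if "0 < y" for y
    proof (rule DERIV_imp_deriv)
      have "((\<lambda>y. (-1) ^ n * (\<Sum>k. d k * (1 / y) ^ k)) has_real_derivative
          (-1) ^ n * - (\<Sum>k. e k * (1 / y) ^ k)) (at y)"
        unfolding e_def using that
        by (intro DERIV_cmult has_field_derivative_power_series_inverse(2) d(2))
      moreover have "\<forall>\<^sub>F z in nhds y. (deriv ^^ n) ?G z = (-1) ^ n * (\<Sum>k. d k * (1 / z) ^ k)"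
        using eventually_nhds_in_open[of "{0<..}" y] that
        by (auto elim!: eventually_mono simp: d(3))
      ultimately show "((deriv ^^ n) ?G has_real_derivative
          (-1) ^ Suc n * (\<Sum>k. e k * (1 / y) ^ k)) (at y)"
        by (subst DERIV_cong_ev[OF refl _ refl]) auto
    qed
    have "(deriv ^^ Suc n) ?G differentiable at y" if "y > 0" for y
    proof (rule differentiableI[OF has_field_derivative_imp_has_derivative])
      have "((\<lambda>y. (-1) ^ Suc n * (\<Sum>k. e k * (1 / y) ^ k)) has_real_derivative
          (-1) ^ Suc n * - (\<Sum>k. (case k of 0 \<Rightarrow> 0 | Suc k \<Rightarrow> real k * e k) * (1 / y) ^ k)) (at y)"
        using that by (intro DERIV_cmult has_field_derivative_power_series_inverse(2) e)
      moreover have "\<forall>\<^sub>F z in nhds y. (deriv ^^ Suc n) ?G z = (-1) ^ Suc n * (\<Sum>k. e k * (1 / z) ^ k)"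
        using eventually_nhds_in_open[of "{0<..}" y] that
        by (auto elim!: eventually_mono simp: deriv)
      ultimately show "((deriv ^^ Suc n) ?G has_real_derivative
          (-1) ^ Suc n * - (\<Sum>k. (case k of 0 \<Rightarrow> 0 | Suc k \<Rightarrow> real k * e k) * (1 / y) ^ k)) (at y)"
        by (subst DERIV_cong_ev[OF refl _ refl]) auto
    qed
    with e deriv show ?case
      by (intro exI[of _ e]) auto
  qed
  show ?thesis
    unfolding completely_monotonic_on_def
  proof (intro allI ballI conjI)
    fix n and y :: real
    assume y: "y \<in> {0<..}"
    obtain d where d: "\<And>k. 0 \<le> d k" "\<And>x. summable (\<lambda>k. d k * x ^ k)"
      "\<And>y. 0 < y \<Longrightarrow> (deriv ^^ n) ?G y = (-1) ^ n * (\<Sum>k. d k * (1 / y) ^ k)"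
      "\<And>y. 0 < y \<Longrightarrow> (deriv ^^ n) ?G differentiable at y" using ex[of n] by blast
    show "(deriv ^^ n) ?G differentiable at y" using d(4) y by simp
    have "(-1) ^ n * (deriv ^^ n) ?G y = (\<Sum>k. d k * (1 / y) ^ k)"
      using y by (simp add: d(3) flip: power_mult_distrib mult.assoc)
    also have "\<dots> \<ge> 0"
      using d(1) y by (intro suminf_nonneg d(2)) auto
    finally show "0 \<le> (-1) ^ n * (deriv ^^ n) ?G y" .
  qed
qed

text \<open>The Hoelder inequality for series, obtained from Young's inequality applied to the terms
  normalised by the two sums.\<close>

lemma multiplicatively_convex_on_pos_power_series:
  fixes c :: "nat \<Rightarrow> real"
  assumes c: "\<And>n. 0 \<le> c n" and summ: "\<And>x. summable (\<lambda>n. c n * x ^ n)"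
    and F: "\<And>x. F x = (\<Sum>n. c n * x ^ n)" and pos: "\<And>x. 0 < x \<Longrightarrow> 0 < F x"
  shows "multiplicatively_convex_on_pos F"
  unfolding multiplicatively_convex_on_pos_def
proof (intro conjI allI impI ballI)
  fix x y t :: real
  assume x: "0 < x" and y: "0 < y" and t: "t \<in> {0..1}"
  define z where "z = x powr t * y powr (1 - t)"
  let ?P = "F x powr t * F y powr (1 - t)"
  have sums: "(\<lambda>n. c n * x ^ n) sums F x" for x
    unfolding F using summ by (rule summable_sums)
  have P: "0 < ?P" using pos[OF x] pos[OF y] by simp
  have "c n * z ^ n / ?P \<le> t / F x * (c n * x ^ n) + (1 - t) / F y * (c n * y ^ n)" for n
  proof -
    have pw: "(w powr s) ^ n = (w ^ n) powr s" if "0 < w" for w s :: real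
      using that by (simp add: powr_powr mult.commute flip: powr_realpow)
    have "z ^ n / ?P = (x ^ n / F x) powr t * (y ^ n / F y) powr (1 - t)"
      using x y pos[OF x] pos[OF y] by (simp add: z_def power_mult_distrib powr_divide pw)
    also have "\<dots> \<le> t * (x ^ n / F x) + (1 - t) * (y ^ n / F y)"
      using x y pos[OF x] pos[OF y] t by (intro Youngs_inequality_0) auto
    finally have "c n * (z ^ n / ?P) \<le> c n * (t * (x ^ n / F x) + (1 - t) * (y ^ n / F y))"
      using c by (intro mult_left_mono)
    then show ?thesis by (simp add: algebra_simps)
  qed
  moreover have "(\<lambda>n. c n * z ^ n / ?P) sums (F z / ?P)"
    by (intro sums_divide sums)
  moreover have "(\<lambda>n. t / F x * (c n * x ^ n) + (1 - t) / F y * (c n * y ^ n)) sums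
      (t / F x * F x + (1 - t) / F y * F y)"
    by (intro sums_add sums_mult sums)
  ultimately have "F z / ?P \<le> t / F x * F x + (1 - t) / F y * F y"
    by (rule sums_le)
  also have "\<dots> = 1" using pos[OF x] pos[OF y] by simp
  finally show "F (x powr t * y powr (1 - t)) \<le> ?P"
    using P by (simp add: z_def)
qed (fact pos)

text \<open>By weighted AM-GM, the reciprocal of a convex combination of \<open>x\<close> and
  \<open>y\<close> is at most the weighted geometric mean of \<open>1 / x\<close> and
  \<open>1 / y\<close>. Monotonicity of \<open>F\<close> and then its multiplicative convexity
  finish the estimate.\<close>

lemma log_convex_on_inverse:
  assumes F: "multiplicatively_convex_on_pos F" and mono: "\<And>x y. 0 < x \<Longrightarrow> x \<le> y \<Longrightarrow> F x \<le> F y"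
  shows "log_convex_on {0<..} (\<lambda>y. F (1 / y))"
  unfolding log_convex_on_def
proof (intro conjI ballI convex_onI)
  have pos: "0 < F x" if "0 < x" for x
    using F that unfolding multiplicatively_convex_on_pos_def by blast
  show "0 < F (1 / y)" if "y \<in> {0<..}" for y
    using that pos by simp
  fix t x y :: real
  assume t: "0 < t" "t < 1" and "x \<in> {0<..}" "y \<in> {0<..}"
  then have x: "0 < x" and y: "0 < y" by auto
  let ?z = "(1 - t) *\<^sub>R x + t *\<^sub>R y"
  have z: "0 < ?z" using x y t by (simp add: add_pos_pos)
  have "x powr (1 - t) * y powr t \<le> ?z"
    using Youngs_inequality_0[of "1 - t" t x y] t x y by simp
  then have "1 / ?z \<le> 1 / (x powr (1 - t) * y powr t)"
    using x y z by (intro divide_left_mono mult_pos_pos) auto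
  also have "\<dots> = (1 / x) powr (1 - t) * (1 / y) powr (1 - (1 - t))"
    using x y by (simp add: powr_divide)
  finally have "F (1 / ?z) \<le> F ((1 / x) powr (1 - t) * (1 / y) powr (1 - (1 - t)))"
    using z by (intro mono) (simp_all del: real_scaleR_def)
  also have "\<dots> \<le> F (1 / x) powr (1 - t) * F (1 / y) powr (1 - (1 - t))"
  proof -
    have "1 - t \<in> {0..1}" using t by auto
    with F x y show ?thesis
      unfolding multiplicatively_convex_on_pos_def by (meson zero_less_divide_1_iff)
  qed
  finally have "ln (F (1 / ?z)) \<le> ln (F (1 / x) powr (1 - t) * F (1 / y) powr t)"
    using pos[of "1 / ?z"] pos[of "1 / x"] pos[of "1 / y"] x y z
    by (subst ln_le_cancel_iff) (simp_all del: real_scaleR_def)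
  also have "\<dots> = (1 - t) * ln (F (1 / x)) + t * ln (F (1 / y))"
    using pos[of "1 / x"] pos[of "1 / y"] x y by (simp add: ln_mult ln_powr)
  finally show "ln (F (1 / ?z)) \<le> (1 - t) * ln (F (1 / x)) + t * ln (F (1 / y))" .
qed (auto simp: convex_real_interval)

lemma power_series_mono:
  fixes c :: "nat \<Rightarrow> real"
  assumes "\<And>n. 0 \<le> c n" "\<And>x. summable (\<lambda>n. c n * x ^ n)" "0 \<le> x" "x \<le> y"
  shows "(\<Sum>n. c n * x ^ n) \<le> (\<Sum>n. c n * y ^ n)"
  using assms by (intro suminf_le mult_left_mono power_mono) auto

text \<open>The integrand is \<open>x ^ Suc n\<close> times the Erlang density of rate
  \<open>1 / x\<close>, whose total mass, its moment of order 0, is 1.\<close>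

lemma nn_integral_power_times_exp:
  fixes x :: real
  assumes x: "0 < x"
  shows "(\<integral>\<^sup>+ t. ennreal (indicator {0..} t * (t ^ n / fact n * exp (- t / x))) \<partial>lborel)
    = ennreal (x ^ Suc n)"
proof -
  have "indicator {0..} t * (t ^ n / fact n * exp (- t / x)) = x ^ Suc n * erlang_density n (1 / x) t" for t
    using x by (auto simp: erlang_density_def power_divide indicator_def)
  then have "(\<integral>\<^sup>+ t. ennreal (indicator {0..} t * (t ^ n / fact n * exp (- t / x))) \<partial>lborel)
      = ennreal (x ^ Suc n) * (\<integral>\<^sup>+ t. ennreal (erlang_density n (1 / x) t) \<partial>lborel)"
    using x by (simp add: ennreal_mult' nn_integral_cmult)
  also have "(\<integral>\<^sup>+ t. ennreal (erlang_density n (1 / x) t) \<partial>lborel) = 1"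
    using nn_integral_erlang_ith_moment[of "1 / x" n 0] x by simp
  finally show ?thesis by simp
qed

text \<open>The representing measure has density \<open>\<Sum>n. c (n + 1) t\<^sup>n / n!\<close>, since
  \<open>x ^ (n + 1)\<close> is the Laplace transform of \<open>t\<^sup>n / n!\<close> at \<open>1 / x\<close>.\<close>

lemma power_series_laplace_representation:
  fixes c :: "nat \<Rightarrow> real"
  assumes c: "\<And>n. 0 \<le> c n" and c0: "c 0 = 0" and summ: "\<And>x. summable (\<lambda>n. c n * x ^ n)"
    and F: "\<And>x. F x = (\<Sum>n. c n * x ^ n)"
  shows "\<exists>\<tau> :: real measure. sets \<tau> = sets borel \<and> emeasure \<tau> {..<0} = 0 \<and>
            (\<forall>x>0. set_integrable \<tau> {0..} (\<lambda>t. exp (- t / x)) \<and>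
                   F x = (LINT t:{0..}|\<tau>. exp (- t / x)))"
proof -
  define q where "q n t = indicator {0..} t * (c (Suc n) * (t ^ n / fact n))" for n and t :: real
  have q_nonneg: "0 \<le> q n t" for n t
    using c by (auto simp: q_def indicator_def)
  have q_meas [measurable]: "q n \<in> borel_measurable borel" for n
    unfolding q_def by measurable
  define \<tau> where "\<tau> = density lborel (\<lambda>t. \<Sum>n. ennreal (q n t))"
  have sets: "sets \<tau> = sets borel" by (simp add: \<tau>_def)
  have "emeasure \<tau> {..<0} = (\<integral>\<^sup>+ t. (\<Sum>n. ennreal (q n t)) * indicator {..<0} t \<partial>lborel)"
    unfolding \<tau>_def by (intro emeasure_density) measurable
  also have "(\<lambda>t. (\<Sum>n. ennreal (q n t)) * indicator {..<0} t) = (\<lambda>t. 0)"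
    by (auto simp: q_def indicator_def fun_eq_iff)
  finally have null: "emeasure \<tau> {..<0} = 0" by simp
  have "has_bochner_integral \<tau> (\<lambda>t. indicator {0..} t *\<^sub>R exp (- t / x)) (F x)" if x: "0 < x" for x
  proof (rule has_bochner_integral_nn_integral)
    show "(\<lambda>t. indicator {0..} t *\<^sub>R exp (- t / x)) \<in> borel_measurable \<tau>"
      using sets by (simp cong: measurable_cong_sets)
    show "0 \<le> F x" unfolding F using c x by (intro suminf_nonneg summ) auto
    have "(\<integral>\<^sup>+ t. ennreal (indicator {0..} t *\<^sub>R exp (- t / x)) \<partial>\<tau>)
        = (\<integral>\<^sup>+ t. (\<Sum>n. ennreal (q n t)) * ennreal (indicator {0..} t *\<^sub>R exp (- t / x)) \<partial>lborel)"
      unfolding \<tau>_def by (intro nn_integral_density) measurable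
    also have "\<dots> = (\<integral>\<^sup>+ t. (\<Sum>n. ennreal (c (Suc n)) *
          ennreal (indicator {0..} t * (t ^ n / fact n * exp (- t / x)))) \<partial>lborel)"
    proof (intro nn_integral_cong)
      fix t :: real
      have "ennreal (q n t) * ennreal (indicator {0..} t *\<^sub>R exp (- t / x))
          = ennreal (c (Suc n)) * ennreal (indicator {0..} t * (t ^ n / fact n * exp (- t / x)))" for n
      proof -
        have "ennreal (q n t) * ennreal (indicator {0..} t *\<^sub>R exp (- t / x))
            = ennreal (q n t * (indicator {0..} t *\<^sub>R exp (- t / x)))"
          using q_nonneg by (intro ennreal_mult'[symmetric])
        also have "q n t * (indicator {0..} t *\<^sub>R exp (- t / x))
            = c (Suc n) * (indicator {0..} t * (t ^ n / fact n * exp (- t / x)))"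
          by (auto simp: q_def indicator_def)
        also have "ennreal \<dots> = ennreal (c (Suc n)) *
            ennreal (indicator {0..} t * (t ^ n / fact n * exp (- t / x)))"
          by (rule ennreal_mult'[OF c])
        finally show ?thesis .
      qed
      then show "(\<Sum>n. ennreal (q n t)) * ennreal (indicator {0..} t *\<^sub>R exp (- t / x))
          = (\<Sum>n. ennreal (c (Suc n)) * ennreal (indicator {0..} t * (t ^ n / fact n * exp (- t / x))))"
        by (simp only: ennreal_suminf_multc[symmetric])
    qed
    \<comment> \<open>All terms are non-negative, so sum and integral may be interchanged.\<close>
    also have "\<dots> = (\<Sum>n. ennreal (c (Suc n)) *
        (\<integral>\<^sup>+ t. ennreal (indicator {0..} t * (t ^ n / fact n * exp (- t / x))) \<partial>lborel))"
      by (subst nn_integral_suminf) (auto simp: nn_integral_cmult)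
    also have "\<dots> = (\<Sum>n. ennreal (c (Suc n) * x ^ Suc n))"
      unfolding nn_integral_power_times_exp[OF x] using c by (simp only: ennreal_mult')
    also have "\<dots> = ennreal (\<Sum>n. c (Suc n) * x ^ Suc n)"
      using x c summable_Suc_iff[of "\<lambda>n. c n * x ^ n"] summ[of x]
      by (intro suminf_ennreal2) (auto simp del: power_Suc)
    \<comment> \<open>Here \<open>c 0 = 0\<close> enters: a constant term would require an atom at 0
      in addition to the density.\<close>
    also have "(\<Sum>n. c (Suc n) * x ^ Suc n) = F x"
      unfolding F using suminf_split_head[OF summ[of x]] c0 by simp
    finally show "(\<integral>\<^sup>+ t. ennreal (indicator {0..} t *\<^sub>R exp (- t / x)) \<partial>\<tau>) = ennreal (F x)" .
  qed auto
  then show ?thesis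
    using sets null
    by (intro exI[of _ \<tau>]) (auto simp: has_bochner_integral_iff set_integrable_def set_lebesgue_integral_def)
qed

section \<open>The parameter derivative of the Kummer function\<close>

lemma pochhammer_le_power_fact:
  fixes x :: real
  assumes "1 \<le> x"
  shows "pochhammer x n \<le> x ^ n * fact n"
proof (induction n)
  case (Suc n)
  have "(x + real n) * pochhammer x n \<le> (x * (1 + real n)) * (x ^ n * fact n)"
    using assms by (intro mult_mono Suc.IH pochhammer_nonneg)
      (auto simp: distrib_left mult_le_cancel_right1)
  then show ?case by (simp add: pochhammer_rec' algebra_simps)
qed simp

text \<open>Once the argument \<open>\<nu> + N\<close> is at least 1, its Pochhammer symbol of
  length \<open>n\<close> is at least \<open>n!\<close>, so \<open>rGamma\<close> decays like
  \<open>1 / n!\<close> and an exponential series dominates the tail. This works for every real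
  \<open>\<nu>\<close>, poles of the gamma function included.\<close>

lemma summable_power_times_rGamma:
  fixes C \<nu> :: real
  assumes C: "0 \<le> C"
  shows "summable (\<lambda>n. C ^ n * \<bar>rGamma (\<nu> + real n)\<bar>)"
proof -
  obtain N :: nat where N: "1 - \<nu> \<le> real N" using real_arch_simple by blast
  have "summable (\<lambda>n. C ^ (n + N) * \<bar>rGamma (\<nu> + real (n + N))\<bar>)"
  proof (rule summable_comparison_test', rule summable_mult)
    show "summable (\<lambda>n. inverse (fact n) * C ^ n)" by (rule summable_exp)
    fix n
    let ?x = "\<nu> + real N"
    have "fact n * \<bar>rGamma (?x + real n)\<bar> \<le> pochhammer ?x n * \<bar>rGamma (?x + real n)\<bar>"
      using pochhammer_mono[of 1 ?x n] N
      by (intro mult_right_mono) (auto simp: pochhammer_fact)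
    also have "\<dots> = \<bar>rGamma ?x\<bar>"
      using pochhammer_rGamma[of ?x n] pochhammer_nonneg[of ?x n] N by (simp add: abs_mult)
    finally have "\<bar>rGamma (?x + real n)\<bar> \<le> \<bar>rGamma ?x\<bar> / fact n"
      by (simp add: field_simps)
    then have "C ^ (n + N) * \<bar>rGamma (?x + real n)\<bar> \<le> C ^ (n + N) * (\<bar>rGamma ?x\<bar> / fact n)"
      using C by (intro mult_left_mono) auto
    then show "norm (C ^ (n + N) * \<bar>rGamma (\<nu> + real (n + N))\<bar>)
        \<le> (C ^ N * \<bar>rGamma ?x\<bar>) * (inverse (fact n) * C ^ n)"
      using C by (simp add: power_add abs_mult field_simps)
  qed
  then show ?thesis by (subst (asm) summable_iff_shift)
qed

section \<open>Positivity, growth and log-concavity of the coefficients \<open>h_k\<close>\<close>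

lemma Digamma_plus_of_nat:
  fixes a :: real
  assumes "0 < a"
  shows "Digamma (a + real k) - Digamma a = (\<Sum>i<k. 1 / (a + real i))"
proof (induction k)
  case (Suc k)
  then show ?case
    using Digamma_plus1[of "a + real k"] assms by (simp add: ac_simps)
qed simp

text \<open>The sum is the logarithmic derivative of \<open>pochhammer a k\<close> in
  \<open>a\<close>, so \<open>hcoeff a k\<close> is the derivative of
  \<open>pochhammer a k / fact k\<close>.\<close>

lemma hcoeff_eq:
  "0 < a \<Longrightarrow> hcoeff a k = (\<Sum>i<k. 1 / (a + real i)) * (pochhammer a k / fact k)"
  by (simp add: hcoeff_def Digamma_plus_of_nat)

lemma hcoeff_0: "hcoeff a 0 = 0"
  by (simp add: hcoeff_def)

lemma hcoeff_Suc_pos: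
  assumes "0 < a"
  shows "0 < hcoeff a (Suc k)"
  unfolding hcoeff_eq[OF assms] using assms
  by (intro mult_pos_pos sum_pos divide_pos_pos pochhammer_pos) (auto simp: add_pos_nonneg)

lemma hcoeff_nonneg: "0 < a \<Longrightarrow> 0 \<le> hcoeff a k"
  using hcoeff_Suc_pos[of a "k - 1"] by (cases k) (auto simp: hcoeff_0)

lemma sum_inverse_le:
  fixes a :: real
  assumes "0 < c" "c \<le> a"
  shows "(\<Sum>i<k. 1 / (a + real i)) \<le> real k / c"
proof -
  have "(\<Sum>i<k. 1 / (a + real i)) \<le> (\<Sum>i<k. 1 / c)"
    using assms by (intro sum_mono divide_left_mono) (auto intro!: mult_pos_pos add_pos_nonneg)
  then show ?thesis by simp
qed

text \<open>A crude geometric bound for convergence proofs: the sum of reciprocals is at most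
  \<open>k\<close>, hence at most \<open>2 ^ k\<close>.\<close>

lemma hcoeff_le:
  assumes a: "1 \<le> a"
  shows "hcoeff a k \<le> (2 * a) ^ k"
proof -
  have a0: "0 < a" using a by simp
  have "(\<Sum>i<k. 1 / (a + real i)) \<le> 2 ^ k"
    using sum_inverse_le[of 1 a k] a by (simp add: order.trans[OF _ of_nat_less_two_power[THEN less_imp_le]])
  moreover have "pochhammer a k / fact k \<le> a ^ k"
    using pochhammer_le_power_fact[OF a, of k] by (simp add: field_simps)
  ultimately have "hcoeff a k \<le> 2 ^ k * a ^ k"
    unfolding hcoeff_eq[OF a0] using a0
    by (intro mult_mono divide_nonneg_nonneg pochhammer_nonneg) auto
  then show ?thesis by (simp add: power_mult_distrib)
qed

text \<open>Both factors \<open>\<psi>(a + k) - \<psi>(a)\<close> and \<open>(a)\<^sub>k / k!\<close> are log-concave in \<open>k\<close>;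
  the second one only because \<open>a \<ge> 1\<close>.\<close>

lemma hcoeff_log_concave:
  assumes a: "1 \<le> a" and pq: "p \<le> q"
  shows "hcoeff a p * hcoeff a (Suc q) \<le> hcoeff a (Suc p) * hcoeff a q"
proof -
  have a0: "0 < a" using a by simp
  define s where "s k = (\<Sum>i<k. 1 / (a + real i))" for k
  define r where "r k = pochhammer a k / fact k" for k
  have s_nonneg: "0 \<le> s k" for k using a0 by (auto simp: s_def intro!: sum_nonneg)
  have r_nonneg: "0 \<le> r k" for k using a0 by (simp add: r_def pochhammer_nonneg)
  have "s p \<le> s q" unfolding s_def using a0 pq by (intro sum_mono2) auto
  moreover have "1 / (a + real q) \<le> 1 / (a + real p)"
    using a0 pq by (intro divide_left_mono) (auto intro!: mult_pos_pos add_pos_nonneg)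
  ultimately have "s p * (1 / (a + real q)) \<le> s q * (1 / (a + real p))"
    using s_nonneg a0 by (intro mult_mono) auto
  \<comment> \<open>As \<open>s (Suc k) = s k + 1 / (a + k)\<close>, the difference of the two sides
    is \<open>s q / (a + p) - s p / (a + q)\<close>.\<close>
  then have s_lc: "s p * s (Suc q) \<le> s (Suc p) * s q"
    by (simp add: s_def algebra_simps)
  have r_lc: "r p * r (Suc q) \<le> r (Suc p) * r q"
  proof -
    have r_Suc: "r (Suc k) = (a + real k) / (1 + real k) * r k" for k
      by (simp add: r_def pochhammer_rec')
    \<comment> \<open>This product is \<open>(a + p) * (1 + q) - (a + q) * (1 + p)\<close>, the next
      inequality cleared of denominators.\<close>
    have "0 \<le> (a - 1) * (real q - real p)" using a pq by (intro mult_nonneg_nonneg) auto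
    then have "(a + real q) / (1 + real q) \<le> (a + real p) / (1 + real p)"
      by (simp add: field_simps)
    then have "(a + real q) / (1 + real q) * (r p * r q) \<le> (a + real p) / (1 + real p) * (r p * r q)"
      using r_nonneg by (intro mult_right_mono) auto
    then show ?thesis by (simp add: r_Suc ac_simps)
  qed
  have "(s p * s (Suc q)) * (r p * r (Suc q)) \<le> (s (Suc p) * s q) * (r (Suc p) * r q)"
    by (rule mult_mono[OF s_lc r_lc]) (simp_all add: s_nonneg r_nonneg)
  moreover have "hcoeff a k = s k * r k" for k
    by (simp only: hcoeff_eq[OF a0] s_def r_def)
  ultimately show ?thesis by (simp add: ac_simps)
qed

section \<open>Termwise differentiation in the parameter\<close>

lemma has_field_derivative_pochhammer:
  fixes b :: real
  assumes "0 < b"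
  shows "((\<lambda>b. pochhammer b n) has_real_derivative
           pochhammer b n * (\<Sum>i<n. 1 / (b + real i))) (at b)"
proof (induction n)
  case (Suc n)
  have "((\<lambda>b. (b + real n) * pochhammer b n) has_real_derivative
      1 * pochhammer b n + pochhammer b n * (\<Sum>i<n. 1 / (b + real i)) * (b + real n)) (at b)"
    by (rule DERIV_mult[OF _ Suc.IH]) (auto intro!: derivative_eq_intros)
  also have "1 * pochhammer b n + pochhammer b n * (\<Sum>i<n. 1 / (b + real i)) * (b + real n)
      = pochhammer b (Suc n) * (\<Sum>i<Suc n. 1 / (b + real i))"
    using assms by (simp add: pochhammer_rec' field_simps)
  finally show ?case by (simp add: pochhammer_rec')
qed simp

text \<open>Weierstrass M-test for the differentiated series on \<open>S\<close>. The interval has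
  \<open>a\<close> in its interior, even for \<open>a = 1\<close>, and stays away from 0, so the
  reciprocals \<open>1 / (b + i)\<close> are at most 2; the right end point \<open>a + 1\<close>
  bounds the Pochhammer symbols.\<close>

lemma has_field_derivative_regularized_kummer:
  fixes a \<nu> x :: real
  assumes a: "1 \<le> a"
  defines "S \<equiv> {1/2..a+1}"
  shows "b \<in> interior S \<Longrightarrow>
           summable (\<lambda>n. pochhammer b n * (rGamma (\<nu> + real n) * x ^ n / fact n))"
    and "((\<lambda>b. \<Sum>n. pochhammer b n * (rGamma (\<nu> + real n) * x ^ n / fact n)) has_real_derivative
           (\<Sum>n. hcoeff a n * rGamma (\<nu> + real n) * x ^ n)) (at a)"
proof -
  define K where "K n = rGamma (\<nu> + real n) * x ^ n / fact n" for n
  define f' where "f' n b = pochhammer b n * (\<Sum>i<n. 1 / (b + real i)) * K n" for n b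
  define M where "M n = 2 * ((2 * (a + 1) * \<bar>x\<bar>) ^ n * \<bar>rGamma (\<nu> + real n)\<bar>)" for n
  have a_in: "a \<in> interior S" using a by (simp add: S_def)
  have poch: "\<bar>pochhammer b n\<bar> \<le> (a + 1) ^ n * fact n" if "b \<in> S" for b n
    using that a pochhammer_mono[of b "a + 1" n] pochhammer_le_power_fact[of "a + 1" n]
      pochhammer_nonneg[of b n] by (simp add: S_def)
  have deriv: "((\<lambda>b. pochhammer b n * K n) has_real_derivative f' n b) (at b within S)" if "b \<in> S" for n b
    unfolding f'_def using that
    by (intro DERIV_cmult_right has_field_derivative_at_within[OF has_field_derivative_pochhammer])
      (auto simp: S_def)
  have "summable M"
    unfolding M_def using a by (intro summable_mult summable_power_times_rGamma) auto
  moreover have "norm (f' n b) \<le> M n" if b: "b \<in> S" for n b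
  proof -
    have "(\<Sum>i<n. 1 / (b + real i)) \<le> real n / (1/2)"
      using b by (intro sum_inverse_le) (auto simp: S_def)
    also have "\<dots> \<le> 2 * 2 ^ n" using of_nat_less_two_power[of n, where 'a = real] by simp
    finally have "\<bar>\<Sum>i<n. 1 / (b + real i)\<bar> \<le> 2 * 2 ^ n"
      using b by (subst abs_of_nonneg) (auto intro!: sum_nonneg simp: S_def)
    then have "norm (f' n b) \<le> ((a + 1) ^ n * fact n) * (2 * 2 ^ n) * \<bar>K n\<bar>"
      unfolding f'_def real_norm_def abs_mult
      using a by (intro mult_mono mult_nonneg_nonneg poch b) auto
    also have "\<dots> = M n"
      by (simp add: M_def K_def abs_mult power_mult_distrib power_abs del: distrib_left_numeral)
    finally show ?thesis .
  qed
  ultimately have conv: "uniformly_convergent_on S (\<lambda>n b. \<Sum>i<n. f' i b)"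
    by (intro Weierstrass_m_test'[of S f' M])
  have "summable (\<lambda>n. pochhammer a n * K n)"
  proof (rule summable_comparison_test')
    show "summable (\<lambda>n. ((a + 1) * \<bar>x\<bar>) ^ n * \<bar>rGamma (\<nu> + real n)\<bar>)"
      using a by (intro summable_power_times_rGamma) auto
    fix n
    have "norm (pochhammer a n * K n) \<le> ((a + 1) ^ n * fact n) * \<bar>K n\<bar>"
      unfolding real_norm_def abs_mult using a_in interior_subset
      by (intro mult_right_mono poch) auto
    then show "norm (pochhammer a n * K n) \<le> ((a + 1) * \<bar>x\<bar>) ^ n * \<bar>rGamma (\<nu> + real n)\<bar>"
      by (simp add: K_def abs_mult power_mult_distrib power_abs ac_simps)
  qed
  note * = has_field_derivative_series'[of S "\<lambda>n b. pochhammer b n * K n" f' a,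
      OF _ deriv conv _ this]
  show "summable (\<lambda>n. pochhammer b n * (rGamma (\<nu> + real n) * x ^ n / fact n))"
    if "b \<in> interior S"
    using *(1)[of b] that a unfolding K_def S_def by simp
  have "f' n a = hcoeff a n * rGamma (\<nu> + real n) * x ^ n" for n
    using a by (simp add: f'_def K_def hcoeff_eq)
  then show "((\<lambda>b. \<Sum>n. pochhammer b n * (rGamma (\<nu> + real n) * x ^ n / fact n)) has_real_derivative
           (\<Sum>n. hcoeff a n * rGamma (\<nu> + real n) * x ^ n)) (at a)"
    using *(2)[of a] a_in a unfolding K_def S_def by simp
qed

lemma hfun_eq_series:
  assumes a: "1 \<le> a"
  shows "hfun a \<nu> x = (\<Sum>k. hcoeff a k * rGamma (\<nu> + real k) * x ^ k)"
proof (cases "\<nu> \<in> \<int>\<^sub>\<le>\<^sub>0")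
  case False
  then have nz: "rGamma \<nu> \<noteq> 0" by (simp add: rGamma_eq_zero_iff)
  let ?f = "\<lambda>b n. pochhammer b n * (rGamma (\<nu> + real n) * x ^ n / fact n)"
  have kummer: "kummer b \<nu> x * rGamma \<nu> = (\<Sum>n. ?f b n)" if b: "b \<in> interior {1/2..a+1}" for b
  proof -
    have "pochhammer b n / (pochhammer \<nu> n * fact n) * x ^ n = ?f b n / rGamma \<nu>" for n
      using pochhammer_rGamma[of \<nu> n] nz by (auto simp: field_simps)
    then have "kummer b \<nu> x = (\<Sum>n. ?f b n) / rGamma \<nu>"
      unfolding kummer_def
      using suminf_divide[OF has_field_derivative_regularized_kummer(1)[OF a b]] by simp
    with nz show ?thesis by simp
  qed
  have "a \<in> interior {1/2..a+1}" using a by simp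
  \<comment> \<open>The derivative at \<open>a\<close> depends only on values near \<open>a\<close>,
    so the series identity is needed only on the interior of the interval.\<close>
  then have "\<forall>\<^sub>F b in nhds a. kummer b \<nu> x * rGamma \<nu> = (\<Sum>n. ?f b n)"
    by (rule eventually_mono[OF eventually_nhds_in_open[OF open_interior]]) (rule kummer)
  then have "((\<lambda>b. kummer b \<nu> x * rGamma \<nu>) has_real_derivative
      (\<Sum>k. hcoeff a k * rGamma (\<nu> + real k) * x ^ k)) (at a)"
    using has_field_derivative_regularized_kummer(2)[OF a] by (subst DERIV_cong_ev[OF refl _ refl]) 
  with False show ?thesis by (simp add: hfun_def DERIV_imp_deriv)
qed (simp add: hfun_def)

section \<open>The series left after division by \<open>x\<close>, and its products\<close>

definition shifted_series :: "real \<Rightarrow> real \<Rightarrow> real \<Rightarrow> real" where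
  "shifted_series a m x = (\<Sum>k. hcoeff a (Suc k) * rGamma (m + real k) * x ^ k)"

lemma summable_hcoeff_series:
  assumes a: "1 \<le> a"
  shows "summable (\<lambda>k. \<bar>hcoeff a k * rGamma (\<nu> + real k) * x ^ k\<bar>)"
proof (rule summable_comparison_test')
  show "summable (\<lambda>n. (2 * a * \<bar>x\<bar>) ^ n * \<bar>rGamma (\<nu> + real n)\<bar>)"
    using a by (intro summable_power_times_rGamma) auto
  fix n
  have "norm \<bar>hcoeff a n * rGamma (\<nu> + real n) * x ^ n\<bar> \<le> (2 * a) ^ n * \<bar>rGamma (\<nu> + real n)\<bar> * \<bar>x ^ n\<bar>"
    unfolding real_norm_def abs_abs abs_mult
    using hcoeff_le[OF a, of n] hcoeff_nonneg[of a n] a by (intro mult_right_mono) auto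
  then show "norm \<bar>hcoeff a n * rGamma (\<nu> + real n) * x ^ n\<bar> \<le> (2 * a * \<bar>x\<bar>) ^ n * \<bar>rGamma (\<nu> + real n)\<bar>"
    by (simp add: power_mult_distrib power_abs ac_simps)
qed

text \<open>Up to the factor \<open>x\<close>, this is the series of h at
  \<open>\<nu> = m - 1\<close> without its zeroth term. Absolute convergence is what the Cauchy
  products require.\<close>

lemma summable_shifted_series:
  assumes a: "1 \<le> a"
  shows "summable (\<lambda>k. \<bar>hcoeff a (Suc k) * rGamma (m + real k) * x ^ k\<bar>)"
proof (cases "x = 0")
  case True
  then show ?thesis
    by (intro summable_finite[of "{0}"]) auto
next
  case False
  have "summable (\<lambda>k. \<bar>hcoeff a (Suc k) * rGamma (m - 1 + real (Suc k)) * x ^ Suc k\<bar>)"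
    using summable_Suc_iff[of "\<lambda>k. \<bar>hcoeff a k * rGamma (m - 1 + real k) * x ^ k\<bar>"]
      summable_hcoeff_series[OF a] by blast
  then have "summable (\<lambda>k. \<bar>x\<bar> * \<bar>hcoeff a (Suc k) * rGamma (m + real k) * x ^ k\<bar>)"
    by (simp add: abs_mult ac_simps)
  with False show ?thesis by (subst (asm) summable_cmult_iff) auto
qed

text \<open>The term \<open>k = 0\<close> vanishes, so \<open>x\<close> factors out. The index
  becomes \<open>m = \<nu> + 1\<close>, so that \<open>\<nu> \<ge> -1\<close> turns into
  \<open>m \<ge> 0\<close>, where all \<open>rGamma\<close> values are non-negative.\<close>

lemma hfun_eq_shifted_series:
  assumes a: "1 \<le> a"
  shows "hfun a \<nu> x = x * shifted_series a (\<nu> + 1) x"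
proof -
  have "hfun a \<nu> x = (\<Sum>k. hcoeff a (Suc k) * rGamma (\<nu> + real (Suc k)) * x ^ Suc k)"
    unfolding hfun_eq_series[OF a]
    by (subst suminf_split_head[OF summable_rabs_cancel[OF summable_hcoeff_series[OF a]]]) (simp add: hcoeff_0)
  also have "\<dots> = (\<Sum>k. x * (hcoeff a (Suc k) * rGamma (\<nu> + 1 + real k) * x ^ k))"
    by (intro suminf_cong) (simp add: ac_simps)
  also have "\<dots> = x * shifted_series a (\<nu> + 1) x"
    unfolding shifted_series_def
    by (intro suminf_mult summable_rabs_cancel[OF summable_shifted_series] a)
  finally show ?thesis .
qed

lemma shifted_series_pos:
  assumes a: "1 \<le> a" and m: "0 \<le> m" and x: "0 < x"
  shows "0 < shifted_series a m x"
  unfolding shifted_series_def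
proof (rule suminf_pos2)
  show "summable (\<lambda>k. hcoeff a (Suc k) * rGamma (m + real k) * x ^ k)"
    by (intro summable_rabs_cancel[OF summable_shifted_series] a)
  show "0 \<le> hcoeff a (Suc k) * rGamma (m + real k) * x ^ k" for k
    using a m x by (intro mult_nonneg_nonneg hcoeff_nonneg rGamma_real_nonneg) auto
  \<comment> \<open>The term of index 1 serves as the positive one, since the term of index 0
    vanishes when \<open>m = 0\<close>.\<close>
  show "0 < hcoeff a (Suc 1) * rGamma (m + real 1) * x ^ 1"
    using a m x by (intro mult_pos_pos hcoeff_Suc_pos rGamma_real_pos) auto
qed

lemma shifted_series_0: "shifted_series a m 0 = hcoeff a 1 * rGamma m"
  unfolding shifted_series_def by (subst powser_zero) simp

lemma isCont_shifted_series:
  assumes a: "1 \<le> a"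
  shows "isCont (shifted_series a m) x"
proof -
  have "((\<lambda>x. \<Sum>k. hcoeff a (Suc k) * rGamma (m + real k) * x ^ k) has_real_derivative
      (\<Sum>k. diffs (\<lambda>k. hcoeff a (Suc k) * rGamma (m + real k)) k * x ^ k)) (at x)"
    by (intro termdiffs_strong_converges_everywhere summable_rabs_cancel[OF summable_shifted_series] a)
  then show ?thesis
    unfolding shifted_series_def[abs_def] by (rule DERIV_isCont)
qed

lemma shifted_series_mult_sums:
  assumes a: "1 \<le> a"
  shows "(\<lambda>n. (\<Sum>j\<le>n. hcoeff a (Suc j) * hcoeff a (Suc (n - j)) *
            (rGamma (m + real j) * rGamma (m' + real (n - j)))) * x ^ n)
         sums (shifted_series a m x * shifted_series a m' x)"
proof -
  let ?f = "\<lambda>m k. hcoeff a (Suc k) * rGamma (m + real k) * x ^ k"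
  have "(\<lambda>n. \<Sum>j\<le>n. ?f m j * ?f m' (n - j)) sums (shifted_series a m x * shifted_series a m' x)"
    unfolding shifted_series_def
    using summable_shifted_series[OF a] by (intro Cauchy_product_sums) auto
  moreover have "(\<Sum>j\<le>n. ?f m j * ?f m' (n - j))
      = (\<Sum>j\<le>n. hcoeff a (Suc j) * hcoeff a (Suc (n - j)) *
            (rGamma (m + real j) * rGamma (m' + real (n - j)))) * x ^ n" for n
    unfolding sum_distrib_right
  proof (intro sum.cong refl)
    fix j assume "j \<in> {..n}"
    then have "x ^ n = x ^ j * x ^ (n - j)" by (simp flip: power_add)
    then show "?f m j * ?f m' (n - j) = hcoeff a (Suc j) * hcoeff a (Suc (n - j)) *
            (rGamma (m + real j) * rGamma (m' + real (n - j))) * x ^ n"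
      by (simp add: ac_simps)
  qed
  ultimately show ?thesis by simp
qed

lemma shifted_series_turanian_sums:
  assumes a: "1 \<le> a"
  shows "(\<lambda>n. (\<Sum>j\<le>n. hcoeff a (Suc j) * hcoeff a (Suc (n - j)) * turan_term m \<beta> j (n - j)) * x ^ n)
    sums (shifted_series a (m + 1) x * shifted_series a (m + \<beta>) x
        - shifted_series a m x * shifted_series a (m + \<beta> + 1) x)"
proof -
  let ?W = "\<lambda>n j. hcoeff a (Suc j) * hcoeff a (Suc (n - j))"
  have "(\<Sum>j\<le>n. ?W n j * (rGamma (m + 1 + real j) * rGamma (m + \<beta> + real (n - j)))) * x ^ n
      - (\<Sum>j\<le>n. ?W n j * (rGamma (m + real j) * rGamma (m + \<beta> + 1 + real (n - j)))) * x ^ n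
      = (\<Sum>j\<le>n. ?W n j * turan_term m \<beta> j (n - j)) * x ^ n" for n
    unfolding left_diff_distrib[symmetric] sum_subtractf[symmetric] right_diff_distrib[symmetric]
      turan_term_eq ..
  with sums_diff[OF shifted_series_mult_sums[OF a, of "m + 1" "m + \<beta>" x]
    shifted_series_mult_sums[OF a, of m "m + \<beta> + 1" x]]
  show ?thesis by (simp only:)
qed

lemma shifted_series_lower_pos:
  assumes a: "1 \<le> a" and \<mu>: "0 < \<mu>" and \<beta>: "0 < \<beta>" and x: "0 < x"
  shows "\<mu> * (shifted_series a (\<mu> + 2) x * shifted_series a (\<mu> + \<beta> + 1) x)
    < (\<mu> + \<beta>) * (shifted_series a (\<mu> + 1) x * shifted_series a (\<mu> + \<beta> + 2) x)"
proof -
  let ?g = "\<lambda>k. hcoeff a (Suc k)"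
  let ?u = "\<lambda>j k. (\<mu> + \<beta>) * (rGamma (\<mu> + 1 + real j) * rGamma (\<mu> + \<beta> + 2 + real k))
     - \<mu> * (rGamma (\<mu> + 2 + real j) * rGamma (\<mu> + \<beta> + 1 + real k))"
  have coeff: "(\<mu> + \<beta>) * ((\<Sum>j\<le>n. ?g j * ?g (n - j) *
          (rGamma (\<mu> + 1 + real j) * rGamma (\<mu> + \<beta> + 2 + real (n - j)))) * x ^ n)
      - \<mu> * ((\<Sum>j\<le>n. ?g j * ?g (n - j) *
          (rGamma (\<mu> + 2 + real j) * rGamma (\<mu> + \<beta> + 1 + real (n - j)))) * x ^ n)
      = (\<Sum>j\<le>n. ?g j * ?g (n - j) * ?u j (n - j)) * x ^ n" for n
    unfolding mult.assoc[symmetric, of _ _ "x ^ n"] left_diff_distrib[symmetric]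
      sum_distrib_left sum_subtractf[symmetric]
    by (intro arg_cong2[where f = "(*)"] sum.cong refl) (simp add: right_diff_distrib ac_simps)
  have sums: "(\<lambda>n. (\<Sum>j\<le>n. ?g j * ?g (n - j) * ?u j (n - j)) * x ^ n) sums
     ((\<mu> + \<beta>) * (shifted_series a (\<mu> + 1) x * shifted_series a (\<mu> + \<beta> + 2) x)
      - \<mu> * (shifted_series a (\<mu> + 2) x * shifted_series a (\<mu> + \<beta> + 1) x))"
    using sums_diff[OF sums_mult[OF shifted_series_mult_sums[OF a, of "\<mu> + 1" "\<mu> + \<beta> + 2" x], of "\<mu> + \<beta>"]
      sums_mult[OF shifted_series_mult_sums[OF a, of "\<mu> + 2" "\<mu> + \<beta> + 1" x], of \<mu>]]
    unfolding coeff .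
  have "0 < (\<Sum>n. (\<Sum>j\<le>n. ?g j * ?g (n - j) * ?u j (n - j)) * x ^ n)"
    using a \<mu> \<beta> x
    by (intro suminf_pos sums_summable[OF sums] mult_pos_pos turan_lower_coeff_pos hcoeff_Suc_pos) auto
  then show ?thesis unfolding sums_unique[OF sums, symmetric] by simp
qed

section \<open>Consequences for h and its Turanian\<close>

lemma hfun_pos:
  assumes "1 \<le> a" "-1 \<le> \<nu>" "0 < x"
  shows "0 < hfun a \<nu> x"
  unfolding hfun_eq_shifted_series[OF assms(1)]
  using assms by (intro mult_pos_pos shifted_series_pos) auto

lemma hfun_at_0: "1 \<le> a \<Longrightarrow> hfun a \<nu> 0 = 0"
  by (simp add: hfun_eq_shifted_series)

text \<open>Each factor of h contributes one \<open>x\<close>, so the Turanian of h at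
  \<open>\<mu>\<close> is \<open>x ^ 2\<close> times that of the shifted series at
  \<open>m = \<mu> + 1\<close>. This moves the positive coefficients \<open>d\<close> by two places
  and leaves two zeros in front.\<close>

lemma turanian_power_series:
  assumes a: "1 \<le> a" and \<mu>: "-1 \<le> \<mu>" and \<beta>: "0 < \<beta>"
  obtains c :: "nat \<Rightarrow> real" where "\<And>x. (\<lambda>n. c n * x ^ n) sums turanian a \<beta> \<mu> x"
    "c 0 = 0" "c 1 = 0" "\<And>n. 2 \<le> n \<Longrightarrow> 0 < c n"
proof -
  define d where "d n = (\<Sum>j\<le>n. hcoeff a (Suc j) * hcoeff a (Suc (n - j)) *
    turan_term (\<mu> + 1) \<beta> j (n - j))" for n
  define c where "c n = (if n < 2 then 0 else d (n - 2))" for n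
  have sums: "(\<lambda>n. c n * x ^ n) sums turanian a \<beta> \<mu> x" for x
  proof -
    have "(\<lambda>n. x\<^sup>2 * (d n * x ^ n)) sums turanian a \<beta> \<mu> x"
      using sums_mult[OF shifted_series_turanian_sums[OF a, of "\<mu> + 1" \<beta> x], of "x\<^sup>2"]
      unfolding turanian_def hfun_eq_shifted_series[OF a] d_def
      by (simp add: algebra_simps power2_eq_square)
    then have "(\<lambda>n. c (n + 2) * x ^ (n + 2)) sums turanian a \<beta> \<mu> x"
      by (simp add: c_def power_add ac_simps power2_eq_square)
    then show ?thesis
      by (subst (asm) sums_iff_shift) (simp add: c_def)
  qed
  have d_pos: "0 < d n" for n
    unfolding d_def using a \<mu> \<beta>
    by (intro turan_coeff_pos[where g = "\<lambda>k. hcoeff a (Suc k)"] hcoeff_Suc_pos hcoeff_log_concave) auto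
  show ?thesis
    by (rule that[of c]) (use d_pos sums in \<open>auto simp: c_def\<close>)
qed

lemma turanian_pos:
  assumes "1 \<le> a" "-1 \<le> \<mu>" "0 < \<beta>" "0 < x"
  shows "0 < turanian a \<beta> \<mu> x"
proof -
  obtain c where c: "\<And>x. (\<lambda>n. c n * x ^ n) sums turanian a \<beta> \<mu> x"
    "c 0 = 0" "c 1 = 0" "\<And>n. 2 \<le> n \<Longrightarrow> 0 < c n"
    using turanian_power_series[OF assms(1-3)] by blast
  have "0 \<le> c n" for n
    using c(2,3) c(4)[of n] by (cases "n = 0 \<or> n = 1") auto
  then have "0 < (\<Sum>n. c n * x ^ n)"
    using c(4)[of 2] assms(4) by (intro suminf_pos2[where i = 2] sums_summable[OF c(1)]) auto
  then show ?thesis using sums_unique[OF c(1)[of x]] by simp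
qed

text \<open>A shift by a positive integer is a succession of unit shifts, for which the increment is a
  Turanian.\<close>

lemma hfun_discrete_wright:
  assumes a: "1 \<le> a" and x: "0 < x" and \<nu>: "0 < \<nu>" and s: "0 < s" and "0 < n"
  shows "hfun a \<nu> x * hfun a (\<nu> + real n + s) x < hfun a (\<nu> + real n) x * hfun a (\<nu> + s) x"
  using \<open>0 < n\<close>
proof (induction n rule: nat_induct_non_zero)
  case 1
  then show ?case
    using turanian_pos[OF a _ s x, of \<nu>] \<nu> by (simp add: turanian_def add.commute add.left_commute)
next
  case (Suc n)
  let ?h = "\<lambda>\<nu>. hfun a \<nu> x"
  let ?k = "\<nu> + real n"
  have pos: "0 < ?h \<nu>" "0 < ?h ?k" "0 < ?h (?k + 1)"
    using a x \<nu> by (auto intro!: hfun_pos)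
  have "?h ?k * ?h (?k + s + 1) < ?h (?k + 1) * ?h (?k + s)"
    using turanian_pos[OF a _ s x, of ?k] \<nu> by (simp add: turanian_def)
  \<comment> \<open>The unit shift at \<open>\<nu> + n\<close> is multiplied by the induction
    hypothesis, after which the positive factor \<open>?h ?k\<close> cancels.\<close>
  then have "?h \<nu> * (?h ?k * ?h (?k + s + 1)) < ?h \<nu> * (?h (?k + 1) * ?h (?k + s))"
    using pos by (intro mult_strict_left_mono)
  also have "\<dots> = ?h (?k + 1) * (?h \<nu> * ?h (?k + s))"
    by (simp add: ac_simps)
  also have "\<dots> < ?h (?k + 1) * (?h ?k * ?h (\<nu> + s))"
    using pos by (intro mult_strict_left_mono Suc.IH)
  finally have "?h ?k * (?h \<nu> * ?h (?k + s + 1)) < ?h ?k * (?h (?k + 1) * ?h (\<nu> + s))"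
    by (simp add: ac_simps)
  then have "?h \<nu> * ?h (?k + s + 1) < ?h (?k + 1) * ?h (\<nu> + s)"
    using pos by (simp add: mult_less_cancel_left)
  then show ?case by (simp add: ac_simps)
qed

lemma turan_ratio_bounds:
  assumes a: "1 \<le> a" and \<mu>: "-1 \<le> \<mu>" and \<beta>: "0 < \<beta>" and \<mu>\<beta>: "0 \<le> \<mu> + \<beta>" and x: "0 < x"
  shows "\<mu> / (\<beta> + \<mu>) < turan_ratio a \<beta> \<mu> x" "turan_ratio a \<beta> \<mu> x < 1"
proof -
  have pos: "0 < hfun a \<mu> x" "0 < hfun a (1 + \<beta> + \<mu>) x" "0 < hfun a (1 + \<mu>) x" "0 < hfun a (\<beta> + \<mu>) x"
    using assms by (auto intro!: hfun_pos)
  show "turan_ratio a \<beta> \<mu> x < 1"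
    using turanian_pos[OF a \<mu> \<beta> x] pos by (simp add: turanian_def turan_ratio_def ac_simps)
  show "\<mu> / (\<beta> + \<mu>) < turan_ratio a \<beta> \<mu> x"
  proof (cases "\<mu> \<le> 0")
    case True
    \<comment> \<open>This includes \<open>\<beta> + \<mu> = 0\<close>, where the quotient is 0 by
      convention.\<close>
    then have "\<mu> / (\<beta> + \<mu>) \<le> 0" using \<mu>\<beta> by (intro divide_nonpos_nonneg) auto
    also have "0 < turan_ratio a \<beta> \<mu> x" using pos by (simp add: turan_ratio_def)
    finally show ?thesis .
  next
    case False
    have "x\<^sup>2 * (\<mu> * (shifted_series a (\<mu> + 2) x * shifted_series a (\<mu> + \<beta> + 1) x))
        < x\<^sup>2 * ((\<mu> + \<beta>) * (shifted_series a (\<mu> + 1) x * shifted_series a (\<mu> + \<beta> + 2) x))"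
      using shifted_series_lower_pos[OF a _ \<beta> x, of \<mu>] False x by (intro mult_strict_left_mono) auto
    then have "\<mu> * (hfun a (1 + \<mu>) x * hfun a (\<beta> + \<mu>) x)
        < (\<beta> + \<mu>) * (hfun a \<mu> x * hfun a (1 + \<beta> + \<mu>) x)"
      unfolding hfun_eq_shifted_series[OF a] by (simp add: ac_simps power2_eq_square)
    then show ?thesis
      using False \<beta> pos by (simp add: turan_ratio_def divide_less_eq less_divide_eq ac_simps)
  qed
qed

text \<open>At \<open>x = 0\<close> the ratio has the form 0/0, so its value there is understood as
  a limit. For \<open>x > 0\<close> the factor \<open>x ^ 2\<close> cancels, and continuity of the
  shifted series leaves a quotient of \<open>rGamma\<close> values, which the recurrence
  simplifies.\<close>

lemma turan_ratio_tendsto_0: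
  assumes a: "1 \<le> a" and \<mu>: "-1 \<le> \<mu>" and \<beta>: "0 < \<beta>"
  shows "(turan_ratio a \<beta> \<mu> \<longlongrightarrow> (\<mu> + 1) / (\<mu> + 1 + \<beta>)) (at_right 0)"
proof -
  let ?S = "shifted_series a"
  have "(?S m \<longlongrightarrow> hcoeff a 1 * rGamma m) (at_right 0)" for m
    using tendsto_mono[OF at_le isCont_shifted_series[OF a, where m = m and x = 0, unfolded isCont_def]]
    by (simp add: shifted_series_0)
  moreover have h1: "0 < hcoeff a 1" using hcoeff_Suc_pos[of a 0] a by simp
  moreover have rG: "0 < rGamma (\<mu> + 2)" "0 < rGamma (\<mu> + 1 + \<beta>)" "0 < rGamma (\<mu> + 2 + \<beta>)"
    using \<mu> \<beta> by (auto intro!: rGamma_real_pos)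
  ultimately have "((\<lambda>x. ?S (\<mu> + 1) x * ?S (\<mu> + 2 + \<beta>) x / (?S (\<mu> + 2) x * ?S (\<mu> + 1 + \<beta>) x)) \<longlongrightarrow>
      hcoeff a 1 * rGamma (\<mu> + 1) * (hcoeff a 1 * rGamma (\<mu> + 2 + \<beta>))
        / (hcoeff a 1 * rGamma (\<mu> + 2) * (hcoeff a 1 * rGamma (\<mu> + 1 + \<beta>)))) (at_right 0)"
    by (intro tendsto_intros) auto
  also have "hcoeff a 1 * rGamma (\<mu> + 1) * (hcoeff a 1 * rGamma (\<mu> + 2 + \<beta>))
        / (hcoeff a 1 * rGamma (\<mu> + 2) * (hcoeff a 1 * rGamma (\<mu> + 1 + \<beta>)))
      = (rGamma (\<mu> + 1) * rGamma (\<mu> + 2 + \<beta>)) / (rGamma (\<mu> + 2) * rGamma (\<mu> + 1 + \<beta>))"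
    using h1 by simp
  also have "\<dots> = (\<mu> + 1) / (\<mu> + 1 + \<beta>)"
  proof -
    have e1: "rGamma (\<mu> + 1) = (\<mu> + 1) * rGamma (\<mu> + 2)"
      using rGamma_plus1[of "\<mu> + 1"] by (simp add: add.assoc)
    have e2: "rGamma (\<mu> + 1 + \<beta>) = (\<mu> + 1 + \<beta>) * rGamma (\<mu> + 2 + \<beta>)"
      using rGamma_plus1[of "\<mu> + 1 + \<beta>"] by (simp add: ac_simps)
    show ?thesis unfolding e1 e2 using rG by simp
  qed
  finally have lim: "((\<lambda>x. ?S (\<mu> + 1) x * ?S (\<mu> + 2 + \<beta>) x / (?S (\<mu> + 2) x * ?S (\<mu> + 1 + \<beta>) x))
      \<longlongrightarrow> (\<mu> + 1) / (\<mu> + 1 + \<beta>)) (at_right 0)" .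
  have "\<forall>\<^sub>F x in at_right 0. ?S (\<mu> + 1) x * ?S (\<mu> + 2 + \<beta>) x / (?S (\<mu> + 2) x * ?S (\<mu> + 1 + \<beta>) x)
      = turan_ratio a \<beta> \<mu> x"
    using eventually_at_right_less[of 0]
  proof (rule eventually_mono)
    fix x :: real
    assume "0 < x"
    then show "?S (\<mu> + 1) x * ?S (\<mu> + 2 + \<beta>) x / (?S (\<mu> + 2) x * ?S (\<mu> + 1 + \<beta>) x)
        = turan_ratio a \<beta> \<mu> x"
      unfolding turan_ratio_def hfun_eq_shifted_series[OF a]
      by (simp add: ac_simps)
  qed
  with lim show ?thesis by (rule Lim_transform_eventually)
qed

theorem theorem5:
  fixes a :: real
  assumes "a \<ge> 1"
  shows
    "(\<forall>x\<ge>0. discrete_wright_log_concave_on {0<..} (\<lambda>\<nu>. hfun a \<nu> x)) \<and>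
     (\<forall>x>0. strictly_discrete_wright_log_concave_on {0<..} (\<lambda>\<nu>. hfun a \<nu> x)) \<and>
     (\<forall>\<mu> \<beta> :: real. \<mu> \<ge> -1 \<and> \<beta> > 0 \<and> \<mu> + \<beta> \<ge> 0 \<longrightarrow>
        (\<exists>c :: nat \<Rightarrow> real.
            (\<forall>x. (\<lambda>n. c n * x ^ n) sums turanian a \<beta> \<mu> x) \<and>
            c 0 = 0 \<and> c 1 = 0 \<and> (\<forall>n\<ge>2. c n > 0)) \<and>
        absolutely_monotonic_on {0<..} (turanian a \<beta> \<mu>) \<and>
        multiplicatively_convex_on_pos (turanian a \<beta> \<mu>) \<and>
        completely_monotonic_on {0<..} (\<lambda>y. turanian a \<beta> \<mu> (1 / y)) \<and>
        log_convex_on {0<..} (\<lambda>y. turanian a \<beta> \<mu> (1 / y)) \<and>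
        (\<exists>\<tau> :: real measure.
            sets \<tau> = sets borel \<and> emeasure \<tau> {..<0} = 0 \<and>
            (\<forall>x>0. set_integrable \<tau> {0..} (\<lambda>t. exp (- t / x)) \<and>
                   turanian a \<beta> \<mu> x = (LINT t:{0..}|\<tau>. exp (- t / x)))) \<and>
        (\<forall>x>0. hfun a (1 + \<mu>) x * hfun a (\<beta> + \<mu>) x \<noteq> 0 \<and>
               \<mu> / (\<beta> + \<mu>) < turan_ratio a \<beta> \<mu> x \<and> turan_ratio a \<beta> \<mu> x < 1) \<and>
        (\<exists>L. (turan_ratio a \<beta> \<mu> \<longlongrightarrow> L) (at_right 0) \<and>
             (\<beta> + \<mu> \<noteq> 0 \<longrightarrow> \<mu> / (\<beta> + \<mu>) < L) \<and> L < 1) \<and>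
        (\<forall>x\<ge>0. turanian a \<beta> \<mu> x \<ge>
                  (hcoeff a 0)\<^sup>2 * \<beta> * rGamma (\<mu> + 1) * rGamma (\<mu> + \<beta> + 1) \<and>
               (turanian a \<beta> \<mu> x =
                  (hcoeff a 0)\<^sup>2 * \<beta> * rGamma (\<mu> + 1) * rGamma (\<mu> + \<beta> + 1)
                \<longleftrightarrow> x = 0)))"
proof (intro conjI allI impI)
  note a = assms
  show strict: "strictly_discrete_wright_log_concave_on {0<..} (\<lambda>\<nu>. hfun a \<nu> x)"
    if "0 < x" for x
    unfolding strictly_discrete_wright_log_concave_on_def
    using hfun_discrete_wright[OF a that] by simp
  show "discrete_wright_log_concave_on {0<..} (\<lambda>\<nu>. hfun a \<nu> x)" if "0 \<le> x" for x
  \<comment> \<open>At \<open>x = 0\<close> every value of h is 0, so only the weak inequality holds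
    there.\<close>
  proof (cases "x = 0")
    case True
    then show ?thesis by (simp add: discrete_wright_log_concave_on_def hfun_at_0[OF a])
  next
    case False
    with that have "0 < x" by simp
    from strict[OF this] show ?thesis
      unfolding discrete_wright_log_concave_on_def strictly_discrete_wright_log_concave_on_def
      by (blast intro: less_imp_le)
  qed
next
  note a = assms
  fix \<mu> \<beta> :: real
  assume *: "-1 \<le> \<mu> \<and> 0 < \<beta> \<and> 0 \<le> \<mu> + \<beta>"
  then have \<mu>: "-1 \<le> \<mu>" and \<beta>: "0 < \<beta>" and \<mu>\<beta>: "0 \<le> \<mu> + \<beta>" by auto
  obtain c where c: "\<And>x. (\<lambda>n. c n * x ^ n) sums turanian a \<beta> \<mu> x"
    "c 0 = 0" "c 1 = 0" "\<And>n. 2 \<le> n \<Longrightarrow> 0 < c n"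
    using turanian_power_series[OF a \<mu> \<beta>] by blast
  have c_nonneg: "0 \<le> c n" for n
    using c(2,3) c(4)[of n] by (cases "n = 0 \<or> n = 1") auto
  note summ = sums_summable[OF c(1)] and eq = sums_unique[OF c(1)]
  note pos = turanian_pos[OF a \<mu> \<beta>]
  note series = c_nonneg summ eq
  show "\<exists>c :: nat \<Rightarrow> real. (\<forall>x. (\<lambda>n. c n * x ^ n) sums turanian a \<beta> \<mu> x) \<and>
      c 0 = 0 \<and> c 1 = 0 \<and> (\<forall>n\<ge>2. c n > 0)"
    using c by blast
  show "absolutely_monotonic_on {0<..} (turanian a \<beta> \<mu>)"
    by (rule absolutely_monotonic_on_power_series[OF series])
  show mconv: "multiplicatively_convex_on_pos (turanian a \<beta> \<mu>)"
    by (rule multiplicatively_convex_on_pos_power_series[OF series pos])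
  show "completely_monotonic_on {0<..} (\<lambda>y. turanian a \<beta> \<mu> (1 / y))"
    by (rule completely_monotonic_on_power_series_inverse[OF series])
  show "log_convex_on {0<..} (\<lambda>y. turanian a \<beta> \<mu> (1 / y))"
    using mconv
  proof (rule log_convex_on_inverse)
    show "turanian a \<beta> \<mu> x \<le> turanian a \<beta> \<mu> y" if "0 < x" "x \<le> y" for x y
      unfolding eq using that by (intro power_series_mono c_nonneg summ) auto
  qed
  show "\<exists>\<tau> :: real measure. sets \<tau> = sets borel \<and> emeasure \<tau> {..<0} = 0 \<and>
      (\<forall>x>0. set_integrable \<tau> {0..} (\<lambda>t. exp (- t / x)) \<and>
             turanian a \<beta> \<mu> x = (LINT t:{0..}|\<tau>. exp (- t / x)))"
    by (rule power_series_laplace_representation[OF c_nonneg c(2) summ eq])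
  show "\<mu> / (\<beta> + \<mu>) < turan_ratio a \<beta> \<mu> x" "turan_ratio a \<beta> \<mu> x < 1" if "0 < x" for x
    using turan_ratio_bounds[OF a \<mu> \<beta> \<mu>\<beta> that] by auto
  show "hfun a (1 + \<mu>) x * hfun a (\<beta> + \<mu>) x \<noteq> 0" if "0 < x" for x
    using hfun_pos[OF a _ that, of "1 + \<mu>"] hfun_pos[OF a _ that, of "\<beta> + \<mu>"] \<mu> \<mu>\<beta> by simp
  show "\<exists>L. (turan_ratio a \<beta> \<mu> \<longlongrightarrow> L) (at_right 0) \<and>
      (\<beta> + \<mu> \<noteq> 0 \<longrightarrow> \<mu> / (\<beta> + \<mu>) < L) \<and> L < 1"
  proof (intro exI conjI impI)
    show "(turan_ratio a \<beta> \<mu> \<longlongrightarrow> (\<mu> + 1) / (\<mu> + 1 + \<beta>)) (at_right 0)"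
      by (rule turan_ratio_tendsto_0[OF a \<mu> \<beta>])
    show "(\<mu> + 1) / (\<mu> + 1 + \<beta>) < 1" using \<mu> \<beta> by simp
    assume "\<beta> + \<mu> \<noteq> 0"
    \<comment> \<open>After clearing denominators, the two sides differ by
      \<open>\<beta>\<close>.\<close>
    then show "\<mu> / (\<beta> + \<mu>) < (\<mu> + 1) / (\<mu> + 1 + \<beta>)"
      using \<mu> \<beta> \<mu>\<beta> by (simp add: divide_less_eq less_divide_eq algebra_simps)
  qed
  \<comment> \<open>Since \<open>h_0\<close> is 0, the bound is 0, and the claim says that the
    Turanian vanishes at 0 and is positive for \<open>x > 0\<close>.\<close>
  show "turanian a \<beta> \<mu> x \<ge> (hcoeff a 0)\<^sup>2 * \<beta> * rGamma (\<mu> + 1) * rGamma (\<mu> + \<beta> + 1)"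
    "(turanian a \<beta> \<mu> x = (hcoeff a 0)\<^sup>2 * \<beta> * rGamma (\<mu> + 1) * rGamma (\<mu> + \<beta> + 1)) \<longleftrightarrow> x = 0"
    if "0 \<le> x" for x
    using pos[of x] that by (cases "x = 0"; simp add: hcoeff_0 turanian_def hfun_at_0[OF a])+
qed

end
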